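(* Let $P$ be a poset that is graded with a corank function, locally finite, and cellular, and let $F$ be a presheaf on $P$. Then there is a natural isomorphism $$HS^*(P;F)\cong HC^*(P;F).$$
   Context: Posets and presheaves. A poset $P$ is viewed as a category with a unique morphism $x\to y$ iff $x\le y$. A presheaf on $P$ is a functor $F:P^{\mathrm{op}}\to\mathbf{Ab}$; write $F^y_x:F(y)\to F(x)$ for the map induced by $x\le y$. A presheaf on $P$ restricts to a presheaf, also written $F$, on any subposet. Nerve and cochains. $N^nP$ is the set of $n$-simplices $\sigma=(\sigma_n\le\sigma_{n-1}\le\cdots\le\sigma_0)$ in $P$; the face map $d_i$ deletes $\sigma_i$. Let $S^n(P;F)=\prod_{\sigma\in N^nP}F(\sigma_n)$ and write $s\cdot\sigma\in F(\sigma_n)$ for the $\sigma$-component of $s$. The differential $d:S^{n-1}(P;F)\to S^n(P;F)$ is $$ds\cdot\sigma=\sum_{i=0}^{n-1}(-1)^i s\cdot d_i\sigma+(-1)^nF^{\sigma_{n-1}}_{\sigma_n}(s\cdot d_n\sigma).$$ Put $HS^*(P;F)=H(S^*(P;F),d)$; these groups are canonically the higher limits $\varprojlim_P^*F$, i.e. the right derived functors of $\varprojlim_P$ evaluated at $F$. By convention $S^*(\varnothing;F)=0$. Relative cohomology. For a subposet $Q\subseteq P$, $S^*(P,Q;F)$ is the kernel of the restriction map $S^*(P;F)\to S^*(Q;F)$, i.e. the cochains $s$ with $s\cdot\sigma=0$ for all $\sigma\in N^*Q$; $HS^*(P,Q;F)$ is its cohomology, and $S^*(P,\varnothing;F)=S^*(P;F)$.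 Graded posets. $x\prec y$ ($y$ covers $x$) means $x<y$ and there is no $z$ with $x<z<y$. $P$ is graded if there is a rank function $\mathrm{rk}:P\to\mathbb Z$ such that $x<y$ implies $\mathrm{rk}(x)<\mathrm{rk}(y)$, and $x\prec y$ implies $\mathrm{rk}(y)=\mathrm{rk}(x)+1$. "Graded with a corank function" means: a rank function is fixed which is bounded above, with maximum $r=\max_x \mathrm{rk}(x)$, and the corank is $|x|=r-\mathrm{rk}(x)\ge 0$. Let $P^k=\{x\in P: |x|\le k\}$ (so $P^k=\varnothing$ for $k<0$). $P$ is locally finite if for every $x\in P$ there are only finitely many $y$ with $x\prec y$. Cellular cohomology. $C^n(P;F)=HS^n(P^n,P^{n-1};F)$, with differential $\delta:C^{n-1}(P;F)\to C^n(P;F)$ the connecting homomorphism of the long exact sequence arising from the short exact sequence $$0\to S^*(P^n,P^{n-1};F)\to S^*(P^n,P^{n-2};F)\to S^*(P^{n-1},P^{n-2};F)\to0.$$ Put $HC^*(P;F)=H(C^*(P;F),\delta)$. Cellular posets. $P$ (graded with a corank function) is cellular if for every presheaf $F$ on $P$ and every $n$, $HS^i(P^n,P^{n-1};F)=0$ for all $i\ne n$. "Natural" means natural in the presheaf $F$. *)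

theory Defs
  imports "HOL-Algebra.Algebra"
begin

text \<open>
  Abelian groups are HOL-Algebra groups, hence written multiplicatively. All complexes are indexed
  by the integers: cochain groups in negative degrees
  are products over the empty set, and skeleta of negative corank are empty.
\<close>

record 'c cochain_complex =
  grp :: "int \<Rightarrow> 'c monoid"
  dif :: "int \<Rightarrow> 'c \<Rightarrow> 'c"  \<comment> \<open>\<open>dif C n\<close> maps degree \<open>n\<close> to degree \<open>n + 1\<close>\<close>

definition cocycles :: "'c cochain_complex \<Rightarrow> int \<Rightarrow> 'c set" where
  "cocycles C n = kernel (grp C n) (grp C (n + 1)) (dif C n)"

definition coboundaries :: "'c cochain_complex \<Rightarrow> int \<Rightarrow> 'c set" where
  "coboundaries C n = dif C (n - 1) ` carrier (grp C (n - 1))"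

definition cohomology :: "'c cochain_complex \<Rightarrow> int \<Rightarrow> 'c set monoid" where
  "cohomology C n = ((grp C n)\<lparr>carrier := cocycles C n\<rparr>) Mod (coboundaries C n)"

definition cohomology_class :: "'c cochain_complex \<Rightarrow> int \<Rightarrow> 'c \<Rightarrow> 'c set" where
  "cohomology_class C n z = coboundaries C n #>\<^bsub>grp C n\<^esub> z"

text \<open>The map on cohomology induced by a cochain map \<open>f\<close> with target \<open>D\<close>.\<close>

definition cohomology_map ::
    "'d cochain_complex \<Rightarrow> (int \<Rightarrow> 'c \<Rightarrow> 'd) \<Rightarrow> int \<Rightarrow> 'c set \<Rightarrow> 'd set" where
  "cohomology_map D f n c = (THE c'. \<exists>z\<in>c. c' = cohomology_class D n (f n z))"

text \<open>
  The connecting homomorphism from degree \<open>n\<close> cohomology of the quotient to degree \<open>n + 1\<close>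
  cohomology of \<open>A\<close>, for a short exact sequence of complexes with injection \<open>i\<close> from \<open>A\<close> to \<open>B\<close>
  and surjection \<open>p\<close> out of \<open>B\<close>: lift a representative of \<open>c\<close> along \<open>p\<close> to \<open>b\<close>, and write the
  differential of \<open>b\<close> as the image under \<open>i\<close> of some \<open>a\<close>.
\<close>

definition connecting_hom ::
    "'c cochain_complex \<Rightarrow> 'd cochain_complex \<Rightarrow> (int \<Rightarrow> 'c \<Rightarrow> 'd) \<Rightarrow> (int \<Rightarrow> 'd \<Rightarrow> 'e) \<Rightarrow>
     int \<Rightarrow> 'e set \<Rightarrow> 'c set" where
  "connecting_hom A B i p n c =
    (THE c'. \<exists>b \<in> carrier (grp B n). \<exists>a \<in> carrier (grp A (n + 1)).
       p n b \<in> c \<and> i (n + 1) a = dif B n b \<and> c' = cohomology_class A (n + 1) a)"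

text \<open>\<open>res F y x\<close>, for \<open>x \<le> y\<close>, is the map from \<open>obj F y\<close> to \<open>obj F x\<close>.\<close>

record ('a, 'b) presheaf =
  obj :: "'a \<Rightarrow> 'b monoid"
  res :: "'a \<Rightarrow> 'a \<Rightarrow> 'b \<Rightarrow> 'b"

definition presheaf_on :: "'a::order set \<Rightarrow> ('a, 'b) presheaf \<Rightarrow> bool" where
  "presheaf_on P F \<longleftrightarrow>
     (\<forall>x\<in>P. comm_group (obj F x)) \<and>
     (\<forall>x\<in>P. \<forall>y\<in>P. x \<le> y \<longrightarrow> res F y x \<in> hom (obj F y) (obj F x)) \<and>
     (\<forall>x\<in>P. \<forall>a\<in>carrier (obj F x). res F x x a = a) \<and>
     (\<forall>x\<in>P. \<forall>y\<in>P. \<forall>z\<in>P. x \<le> y \<longrightarrow> y \<le> z \<longrightarrow>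
        (\<forall>a\<in>carrier (obj F z). res F y x (res F z y a) = res F z x a))"

definition presheaf_hom ::
    "'a::order set \<Rightarrow> ('a, 'b) presheaf \<Rightarrow> ('a, 'b) presheaf \<Rightarrow> ('a \<Rightarrow> 'b \<Rightarrow> 'b) \<Rightarrow> bool" where
  "presheaf_hom P F G \<eta> \<longleftrightarrow>
     (\<forall>x\<in>P. \<eta> x \<in> hom (obj F x) (obj G x)) \<and>
     (\<forall>x\<in>P. \<forall>y\<in>P. x \<le> y \<longrightarrow>
        (\<forall>a\<in>carrier (obj F y). \<eta> x (res F y x a) = res G y x (\<eta> y a)))"

text \<open>
  A simplex with vertices \<open>\<sigma>\<^sub>n \<le> \<dots> \<le> \<sigma>\<^sub>0\<close> is the list \<open>[\<sigma>\<^sub>0, \<dots>, \<sigma>\<^sub>n]\<close>; it may be degenerate.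
\<close>

definition nerve :: "int \<Rightarrow> 'a::order set \<Rightarrow> 'a list set" where
  "nerve n P = {\<sigma>. \<sigma> \<noteq> [] \<and> int (length \<sigma>) = n + 1 \<and> set \<sigma> \<subseteq> P \<and> sorted_wrt (\<lambda>x y. y \<le> x) \<sigma>}"

definition face :: "nat \<Rightarrow> 'a list \<Rightarrow> 'a list" where
  "face i \<sigma> = take i \<sigma> @ drop (Suc i) \<sigma>"

text \<open>The case \<open>m = 0\<close> below is the zero map out of the trivial group in degree \<open>-1\<close>.\<close>

definition cochain_differential ::
    "'a::order set \<Rightarrow> ('a, 'b) presheaf \<Rightarrow> int \<Rightarrow> ('a list \<Rightarrow> 'b) \<Rightarrow> 'a list \<Rightarrow> 'b" where
  "cochain_differential P F n s =
    (\<lambda>\<sigma> \<in> nerve (n + 1) P.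
       let m = length \<sigma> - 1; G = obj F (\<sigma> ! m) in
       if m = 0 then \<one>\<^bsub>G\<^esub>
       else (\<Otimes>\<^bsub>G\<^esub>i\<in>{..<m}. s (face i \<sigma>) [^]\<^bsub>G\<^esub> ((- 1) ^ i :: int)) \<otimes>\<^bsub>G\<^esub>
            (res F (\<sigma> ! (m - 1)) (\<sigma> ! m) (s (face m \<sigma>))) [^]\<^bsub>G\<^esub> ((- 1) ^ m :: int))"

definition cochains :: "'a::order set \<Rightarrow> ('a, 'b) presheaf \<Rightarrow> ('a list \<Rightarrow> 'b) cochain_complex" where
  "cochains P F =
    \<lparr>grp = (\<lambda>n. product_group (nerve n P) (\<lambda>\<sigma>. obj F (last \<sigma>))),
     dif = cochain_differential P F\<rparr>"

definition cochain_restrict :: "'a::order set \<Rightarrow> int \<Rightarrow> ('a list \<Rightarrow> 'b) \<Rightarrow> 'a list \<Rightarrow> 'b" where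
  "cochain_restrict Q n s = restrict s (nerve n Q)"

definition rel_cochains ::
    "'a::order set \<Rightarrow> 'a set \<Rightarrow> ('a, 'b) presheaf \<Rightarrow> ('a list \<Rightarrow> 'b) cochain_complex" where
  "rel_cochains P Q F =
    \<lparr>grp = (\<lambda>n. (grp (cochains P F) n)
        \<lparr>carrier := kernel (grp (cochains P F) n) (grp (cochains Q F) n) (cochain_restrict Q n)\<rparr>),
     dif = dif (cochains P F)\<rparr>"

definition cochain_push ::
    "'a::order set \<Rightarrow> ('a \<Rightarrow> 'b \<Rightarrow> 'b) \<Rightarrow> int \<Rightarrow> ('a list \<Rightarrow> 'b) \<Rightarrow> 'a list \<Rightarrow> 'b" where
  "cochain_push P \<eta> n s = (\<lambda>\<sigma> \<in> nerve n P. \<eta> (last \<sigma>) (s \<sigma>))"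

definition HS :: "'a::order set \<Rightarrow> ('a, 'b) presheaf \<Rightarrow> int \<Rightarrow> ('a list \<Rightarrow> 'b) set monoid" where
  "HS P F n = cohomology (cochains P F) n"

definition HS_rel ::
    "'a::order set \<Rightarrow> 'a set \<Rightarrow> ('a, 'b) presheaf \<Rightarrow> int \<Rightarrow> ('a list \<Rightarrow> 'b) set monoid" where
  "HS_rel P Q F n = cohomology (rel_cochains P Q F) n"

definition HS_map ::
    "'a::order set \<Rightarrow> ('a, 'b) presheaf \<Rightarrow> ('a \<Rightarrow> 'b \<Rightarrow> 'b) \<Rightarrow> int \<Rightarrow>
     ('a list \<Rightarrow> 'b) set \<Rightarrow> ('a list \<Rightarrow> 'b) set" where
  "HS_map P G \<eta> = cohomology_map (cochains P G) (cochain_push P \<eta>)"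

definition HS_rel_map ::
    "'a::order set \<Rightarrow> 'a set \<Rightarrow> ('a, 'b) presheaf \<Rightarrow> ('a \<Rightarrow> 'b \<Rightarrow> 'b) \<Rightarrow> int \<Rightarrow>
     ('a list \<Rightarrow> 'b) set \<Rightarrow> ('a list \<Rightarrow> 'b) set" where
  "HS_rel_map P Q G \<eta> = cohomology_map (rel_cochains P Q G) (cochain_push P \<eta>)"

definition covers_in :: "'a::order set \<Rightarrow> 'a \<Rightarrow> 'a \<Rightarrow> bool" where
  "covers_in P x y \<longleftrightarrow> x \<in> P \<and> y \<in> P \<and> x < y \<and> \<not> (\<exists>z\<in>P. x < z \<and> z < y)"

definition rank_function :: "'a::order set \<Rightarrow> ('a \<Rightarrow> int) \<Rightarrow> bool" where
  "rank_function P rk \<longleftrightarrow>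
     (\<forall>x\<in>P. \<forall>y\<in>P. x < y \<longrightarrow> rk x < rk y) \<and>
     (\<forall>x y. covers_in P x y \<longrightarrow> rk y = rk x + 1)"

definition graded_with_corank :: "'a::order set \<Rightarrow> ('a \<Rightarrow> int) \<Rightarrow> bool" where
  "graded_with_corank P rk \<longleftrightarrow> rank_function P rk \<and> bdd_above (rk ` P)"

text \<open>A nonempty set of integers that is bounded above attains its supremum, the maximal rank.\<close>

definition corank :: "'a::order set \<Rightarrow> ('a \<Rightarrow> int) \<Rightarrow> 'a \<Rightarrow> int" where
  "corank P rk x = (SUP y\<in>P. rk y) - rk x"

definition skeleton :: "'a::order set \<Rightarrow> ('a \<Rightarrow> int) \<Rightarrow> int \<Rightarrow> 'a set" where
  "skeleton P rk k = {x \<in> P. corank P rk x \<le> k}"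

definition locally_finite_poset :: "'a::order set \<Rightarrow> bool" where
  "locally_finite_poset P \<longleftrightarrow> (\<forall>x\<in>P. finite {y. covers_in P x y})"

text \<open>
  A formula cannot quantify over types, so the type argument fixes the type that the groups
  \<open>obj F x\<close> live in. Their carriers are arbitrary subsets of it.
\<close>

definition cellular :: "'b itself \<Rightarrow> 'a::order set \<Rightarrow> ('a \<Rightarrow> int) \<Rightarrow> bool" where
  "cellular _ P rk \<longleftrightarrow>
     (\<forall>F :: ('a, 'b) presheaf. presheaf_on P F \<longrightarrow>
       (\<forall>n i. i \<noteq> n \<longrightarrow> trivial_group (HS_rel (skeleton P rk n) (skeleton P rk (n - 1)) F i)))"

definition cellular_differential ::
    "'a::order set \<Rightarrow> ('a \<Rightarrow> int) \<Rightarrow> ('a, 'b) presheaf \<Rightarrow> int \<Rightarrow>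
     ('a list \<Rightarrow> 'b) set \<Rightarrow> ('a list \<Rightarrow> 'b) set" where
  "cellular_differential P rk F n =
    connecting_hom
      (rel_cochains (skeleton P rk (n + 1)) (skeleton P rk n) F)
      (rel_cochains (skeleton P rk (n + 1)) (skeleton P rk (n - 1)) F)
      (\<lambda>m s. s) (cochain_restrict (skeleton P rk n)) n"

definition cellular_cochains ::
    "'a::order set \<Rightarrow> ('a \<Rightarrow> int) \<Rightarrow> ('a, 'b) presheaf \<Rightarrow> ('a list \<Rightarrow> 'b) set cochain_complex" where
  "cellular_cochains P rk F =
    \<lparr>grp = (\<lambda>n. HS_rel (skeleton P rk n) (skeleton P rk (n - 1)) F n),
     dif = cellular_differential P rk F\<rparr>"

definition HC ::
    "'a::order set \<Rightarrow> ('a \<Rightarrow> int) \<Rightarrow> ('a, 'b) presheaf \<Rightarrow> int \<Rightarrow> ('a list \<Rightarrow> 'b) set set monoid" where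
  "HC P rk F n = cohomology (cellular_cochains P rk F) n"

definition HC_map ::
    "'a::order set \<Rightarrow> ('a \<Rightarrow> int) \<Rightarrow> ('a, 'b) presheaf \<Rightarrow> ('a \<Rightarrow> 'b \<Rightarrow> 'b) \<Rightarrow> int \<Rightarrow>
     ('a list \<Rightarrow> 'b) set set \<Rightarrow> ('a list \<Rightarrow> 'b) set set" where
  "HC_map P rk G \<eta> =
    cohomology_map (cellular_cochains P rk G)
      (\<lambda>n. HS_rel_map (skeleton P rk n) (skeleton P rk (n - 1)) G \<eta> n)"

end

theory Submission
  imports Defs
begin

text \<open>
  Filter the cochain complex \<open>S\<close> of the presheaf by the subcomplexes \<open>K k\<close> of cochains that vanish on
  the simplices of the \<open>k\<close>-skeleton. The filtration is decreasing, starts with \<open>K (-1) = S\<close>, and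
  \<open>K (k - 1) / K k\<close> is the relative complex of the pair of skeleta \<open>k\<close> and \<open>k - 1\<close>, so that cellularity
  says that its cohomology is concentrated in degree \<open>k\<close>. A simplex has finitely many vertices and hence
  lies in some skeleton; therefore \<open>S\<close> is the inverse limit of the quotients \<open>S / K k\<close>.

  Two vanishing results follow. \<open>S / K k\<close> has no cohomology in degrees above \<open>k\<close>: only finitely many
  graded pieces are involved, and they are removed one at a time (\<open>coboundary_mod_K\<close>). \<open>K k\<close> has no
  cohomology in degrees up to \<open>k\<close>: here infinitely many graded pieces are involved, and the
  corrections made for them converge by completeness (\<open>K_acyclic_below\<close>).

  Cellular cochains of degree \<open>n\<close> are classes \<open>\<gamma> s\<close> of cochains \<open>s\<close> in \<open>K (n - 1)\<close> with \<open>d s\<close> in \<open>K n\<close>,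
  and the cellular differential sends \<open>\<gamma> s\<close> to \<open>\<gamma> (d s)\<close>. By the first vanishing result, every class of
  \<open>S\<close> in degree \<open>n\<close> is represented by a cocycle in \<open>K (n - 1)\<close>; the comparison map sends it to
  the class of \<open>\<gamma> s\<close>. Both the cohomology of \<open>S\<close> and that of the cellular complex are thereby quotients of
  the group of cocycles in \<open>K (n - 1)\<close>, and the two vanishing results show that the quotient maps have
  the same kernel (\<open>class_\<gamma>_eq_one_iff\<close>) and are onto. The comparison map is natural since a morphism of
  presheaves acts on all of these data simplexwise.

  Groups are multiplicative in the formal text; comments write them additively.
\<close>

section \<open>Cochain complexes and their cohomology\<close>

text \<open>
  Both targets are the quotient of \<open>G\<close> by the common kernel.
\<close>

lemma iso_of_same_kernel:
  assumes "group G" "group H" "group L"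
    and f: "f \<in> hom G H" "f ` carrier G = carrier H"
    and g: "g \<in> hom G L" "g ` carrier G = carrier L"
    and ker: "\<And>x. x \<in> carrier G \<Longrightarrow> f x = \<one>\<^bsub>H\<^esub> \<longleftrightarrow> g x = \<one>\<^bsub>L\<^esub>"
    and \<phi>: "\<And>x. x \<in> carrier G \<Longrightarrow> \<phi> (f x) = g x"
  shows "\<phi> \<in> iso H L"
proof -
  interpret f: group_hom G H f using assms by (simp add: group_hom_def group_hom_axioms_def)
  interpret g: group_hom G L g using assms by (simp add: group_hom_def group_hom_axioms_def)
  have lift: "\<exists>x\<in>carrier G. y = f x" if "y \<in> carrier H" for y
    using that f(2) by blast
  have "\<phi> \<in> hom H L"
  proof (rule homI)
    fix y z assume "y \<in> carrier H" "z \<in> carrier H"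
    then obtain x w where "x \<in> carrier G" "w \<in> carrier G" "y = f x" "z = f w"
      using lift by meson
    then show "\<phi> (y \<otimes>\<^bsub>H\<^esub> z) = \<phi> y \<otimes>\<^bsub>L\<^esub> \<phi> z"
      using \<phi>[of "x \<otimes>\<^bsub>G\<^esub> w"] by (simp add: \<phi>)
  qed (use lift \<phi> in force)
  moreover have "\<phi> ` carrier H = carrier L"
    using \<phi> by (force simp flip: f(2) g(2))
  moreover have "inj_on \<phi> (carrier H)"
  proof (subst inj_on_one_iff'[OF \<open>\<phi> \<in> hom H L\<close> assms(2,3)], intro allI impI)
    fix y assume "y \<in> carrier H" "\<phi> y = \<one>\<^bsub>L\<^esub>"
    then show "y = \<one>\<^bsub>H\<^esub>"
      using lift \<phi> ker by metis
  qed
  ultimately show ?thesis by (simp add: iso_def bij_betw_def)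
qed

locale complex =
  fixes C :: "'c cochain_complex"
  assumes comm_group_grp: "comm_group (grp C n)"
    and dif_hom: "dif C n \<in> hom (grp C n) (grp C (n + 1))"
    and dif_dif: "x \<in> carrier (grp C (n - 1)) \<Longrightarrow> dif C n (dif C (n - 1) x) = \<one>\<^bsub>grp C (n + 1)\<^esub>"
begin

sublocale grp: comm_group "grp C n" for n
  by (rule comm_group_grp)

sublocale dif: group_hom "grp C n" "grp C (n + 1)" "dif C n" for n
  by unfold_locales (rule dif_hom)

text \<open>
  The differential out of degree \<open>n - 1\<close> lands in degree \<open>n - 1 + 1\<close>. The simplifier rewrites this
  index to \<open>n\<close>, after which the homomorphism laws no longer match; hence these restatements.
\<close>

lemma dif_closed_pred: "x \<in> carrier (grp C (n - 1)) \<Longrightarrow> dif C (n - 1) x \<in> carrier (grp C n)"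
  using dif.hom_closed[of x "n - 1"] by simp

lemma dif_mult_pred:
  "x \<in> carrier (grp C (n - 1)) \<Longrightarrow> y \<in> carrier (grp C (n - 1)) \<Longrightarrow>
     dif C (n - 1) (x \<otimes>\<^bsub>grp C (n - 1)\<^esub> y) = dif C (n - 1) x \<otimes>\<^bsub>grp C n\<^esub> dif C (n - 1) y"
  using dif.hom_mult[of x "n - 1" y] by simp

lemma dif_inv_pred:
  "x \<in> carrier (grp C (n - 1)) \<Longrightarrow>
     dif C (n - 1) (inv\<^bsub>grp C (n - 1)\<^esub> x) = inv\<^bsub>grp C n\<^esub> dif C (n - 1) x"
  using dif.hom_inv[of x "n - 1"] by simp

lemma dif_one_pred: "dif C (n - 1) \<one>\<^bsub>grp C (n - 1)\<^esub> = \<one>\<^bsub>grp C n\<^esub>"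
  using dif.hom_one[of "n - 1"] by simp

lemma dif_dif_Suc: "x \<in> carrier (grp C n) \<Longrightarrow> dif C (n + 1) (dif C n x) = \<one>\<^bsub>grp C (n + 1 + 1)\<^esub>"
  using dif_dif[of x "n + 1"] by simp

lemma cocycles_iff: "z \<in> cocycles C n \<longleftrightarrow> z \<in> carrier (grp C n) \<and> dif C n z = \<one>\<^bsub>grp C (n + 1)\<^esub>"
  by (simp add: cocycles_def kernel_def)

lemma subgroup_cocycles: "subgroup (cocycles C n) (grp C n)"
  unfolding cocycles_def by (rule dif.subgroup_kernel)

lemma subgroup_coboundaries: "subgroup (coboundaries C n) (grp C n)"
  unfolding coboundaries_def using dif.img_is_subgroup[of "n - 1"] by simp

lemma coboundaries_subset: "coboundaries C n \<subseteq> cocycles C n"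
  by (auto simp: coboundaries_def cocycles_iff dif_dif dif_closed_pred)

lemma comm_group_cocycles: "comm_group ((grp C n)\<lparr>carrier := cocycles C n\<rparr>)"
proof -
  interpret Z: group "(grp C n)\<lparr>carrier := cocycles C n\<rparr>"
    by (rule subgroup.subgroup_is_group[OF subgroup_cocycles grp.is_group])
  show ?thesis
    by (rule Z.group_comm_groupI) (auto simp: cocycles_iff grp.m_comm)
qed

lemma subgroup_coboundaries_cocycles:
  "subgroup (coboundaries C n) ((grp C n)\<lparr>carrier := cocycles C n\<rparr>)"
  by (rule grp.subgroup_incl[OF subgroup_coboundaries subgroup_cocycles coboundaries_subset])

lemma comm_group_cohomology: "comm_group (cohomology C n)"
  unfolding cohomology_def
  by (rule comm_group.abelian_FactGroup[OF comm_group_cocycles subgroup_coboundaries_cocycles])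

lemma cohomology_class_hom:
  "cohomology_class C n \<in> hom ((grp C n)\<lparr>carrier := cocycles C n\<rparr>) (cohomology C n)"
proof -
  have "normal (coboundaries C n) ((grp C n)\<lparr>carrier := cocycles C n\<rparr>)"
    by (rule comm_group.subgroup_imp_normal[OF comm_group_cocycles subgroup_coboundaries_cocycles])
  from normal.r_coset_hom_Mod[OF this] show ?thesis
    by (simp add: cohomology_def cohomology_class_def[abs_def] r_coset_def)
qed

lemma carrier_cohomology: "carrier (cohomology C n) = cohomology_class C n ` cocycles C n"
  by (simp add: cohomology_def cohomology_class_def[abs_def] carrier_FactGroup r_coset_def)

lemma cohomology_class_eq_iff:
  assumes "z \<in> cocycles C n" "w \<in> cocycles C n"
  shows "cohomology_class C n z = cohomology_class C n w \<longleftrightarrow> z \<otimes>\<^bsub>grp C n\<^esub> inv\<^bsub>grp C n\<^esub> w \<in> coboundaries C n"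
proof -
  have "z \<in> carrier (grp C n)" "w \<in> carrier (grp C n)"
    using assms by (auto simp: cocycles_iff)
  then show ?thesis
    unfolding cohomology_class_def
    by (metis grp.repr_independence grp.rcos_self subgroup.rcos_module[OF subgroup_coboundaries grp.is_group]
        subgroup_coboundaries)
qed

lemma one_cohomology: "\<one>\<^bsub>cohomology C n\<^esub> = coboundaries C n"
  by (simp add: cohomology_def)

lemma cohomology_class_eq_one_iff:
  assumes "z \<in> cocycles C n"
  shows "cohomology_class C n z = \<one>\<^bsub>cohomology C n\<^esub> \<longleftrightarrow> z \<in> coboundaries C n"
proof -
  have z: "z \<in> carrier (grp C n)" using assms by (simp add: cocycles_iff)
  then show ?thesis
    unfolding cohomology_class_def one_cohomology
    by (metis grp.coset_join2 grp.rcos_self subgroup_coboundaries)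
qed

lemma cohomology_class_memD:
  assumes "w \<in> cohomology_class C n z" "z \<in> cocycles C n"
  shows "w \<in> cocycles C n" "cohomology_class C n w = cohomology_class C n z"
proof -
  have z: "z \<in> carrier (grp C n)" using assms by (simp add: cocycles_iff)
  obtain b where "b \<in> coboundaries C n" "w = b \<otimes>\<^bsub>grp C n\<^esub> z"
    using assms by (auto simp: cohomology_class_def r_coset_def)
  then show "w \<in> cocycles C n"
    using coboundaries_subset assms(2) subgroup.m_closed[OF subgroup_cocycles] by blast
  show "cohomology_class C n w = cohomology_class C n z"
    using grp.repr_independence[OF _ z subgroup_coboundaries] assms(1)
    by (simp add: cohomology_class_def)
qed

lemma cohomology_class_self: "z \<in> cocycles C n \<Longrightarrow> z \<in> cohomology_class C n z"
  unfolding cohomology_class_def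
  by (rule grp.rcos_self[OF _ subgroup_coboundaries]) (simp add: cocycles_iff)

lemma complex_subcomplex:
  assumes "\<And>n. subgroup (K n) (grp C n)"
    and "\<And>n x. x \<in> K n \<Longrightarrow> dif C n x \<in> K (n + 1)"
  shows "complex \<lparr>grp = (\<lambda>n. (grp C n)\<lparr>carrier := K n\<rparr>), dif = dif C\<rparr>" (is "complex ?K")
proof (rule complex.intro)
  have mem: "x \<in> K n \<Longrightarrow> x \<in> carrier (grp C n)" for x n
    by (rule subgroup.mem_carrier[OF assms(1)])
  show "comm_group (grp ?K n)" for n
    using group.group_comm_groupI[OF subgroup.subgroup_is_group[OF assms(1) grp.is_group]]
    by (simp add: mem grp.m_comm)
  show "dif ?K n \<in> hom (grp ?K n) (grp ?K (n + 1))" for n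
    by (auto intro!: homI simp: mem assms(2))
qed (simp add: dif_dif subgroup.mem_carrier[OF assms(1)])

end

locale cochain_map = C: complex C + D: complex D
  for C :: "'c cochain_complex" and D :: "'d cochain_complex" +
  fixes f :: "int \<Rightarrow> 'c \<Rightarrow> 'd"
  assumes map_hom: "f n \<in> hom (grp C n) (grp D n)"
    and map_dif: "x \<in> carrier (grp C n) \<Longrightarrow> f (n + 1) (dif C n x) = dif D n (f n x)"
begin

sublocale map: group_hom "grp C n" "grp D n" "f n" for n
  by unfold_locales (rule map_hom)

lemma map_dif_pred: "x \<in> carrier (grp C (n - 1)) \<Longrightarrow> f n (dif C (n - 1) x) = dif D (n - 1) (f (n - 1) x)"
  using map_dif[of x "n - 1"] by simp

lemma map_cocycle: "z \<in> cocycles C n \<Longrightarrow> f n z \<in> cocycles D n"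
  using map_dif[of z n, symmetric] by (simp add: C.cocycles_iff D.cocycles_iff)

lemma map_coboundary: "z \<in> coboundaries C n \<Longrightarrow> f n z \<in> coboundaries D n"
  by (auto simp: coboundaries_def map_dif_pred)

text \<open>
  The class on the right does not depend on the representative because \<open>f\<close> maps coboundaries to
  coboundaries. All induced maps on cohomology are evaluated through this equation.
\<close>

lemma cohomology_map_class:
  assumes z: "z \<in> cocycles C n"
  shows "cohomology_map D f n (cohomology_class C n z) = cohomology_class D n (f n z)"
  unfolding cohomology_map_def
proof (rule the_equality)
  show "\<exists>w\<in>cohomology_class C n z. cohomology_class D n (f n z) = cohomology_class D n (f n w)"
    using C.cohomology_class_self[OF z] by blast
  fix c' assume "\<exists>w\<in>cohomology_class C n z. c' = cohomology_class D n (f n w)"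
  then obtain w where w: "w \<in> cohomology_class C n z" "c' = cohomology_class D n (f n w)" by blast
  note w' = C.cohomology_class_memD[OF w(1) z]
  from w' z have "w \<otimes>\<^bsub>grp C n\<^esub> inv\<^bsub>grp C n\<^esub> z \<in> coboundaries C n"
    by (simp add: C.cohomology_class_eq_iff)
  from map_coboundary[OF this] have "f n w \<otimes>\<^bsub>grp D n\<^esub> inv\<^bsub>grp D n\<^esub> f n z \<in> coboundaries D n"
    using w' z by (simp add: C.cocycles_iff)
  then show "c' = cohomology_class D n (f n z)"
    using w' z w(2) by (simp add: D.cohomology_class_eq_iff map_cocycle)
qed

lemma cohomology_map_hom: "cohomology_map D f n \<in> hom (cohomology C n) (cohomology D n)"
proof (rule homI)
  fix c assume "c \<in> carrier (cohomology C n)"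
  then obtain z where z: "z \<in> cocycles C n" "c = cohomology_class C n z"
    by (auto simp: C.carrier_cohomology)
  then show "cohomology_map D f n c \<in> carrier (cohomology D n)"
    by (simp add: cohomology_map_class map_cocycle D.carrier_cohomology)
next
  fix c c' assume "c \<in> carrier (cohomology C n)" "c' \<in> carrier (cohomology C n)"
  then obtain z z' where z: "z \<in> cocycles C n" "c = cohomology_class C n z"
    "z' \<in> cocycles C n" "c' = cohomology_class C n z'"
    by (auto simp: C.carrier_cohomology)
  have zz: "z \<otimes>\<^bsub>grp C n\<^esub> z' \<in> cocycles C n"
    using z by (blast intro: subgroup.m_closed[OF C.subgroup_cocycles])
  have "c \<otimes>\<^bsub>cohomology C n\<^esub> c' = cohomology_class C n (z \<otimes>\<^bsub>grp C n\<^esub> z')"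
    using hom_mult[OF C.cohomology_class_hom, of z n z'] z by simp
  then show "cohomology_map D f n (c \<otimes>\<^bsub>cohomology C n\<^esub> c') =
      cohomology_map D f n c \<otimes>\<^bsub>cohomology D n\<^esub> cohomology_map D f n c'"
    using hom_mult[OF D.cohomology_class_hom, of "f n z" n "f n z'"] z zz
    by (simp add: cohomology_map_class map_cocycle C.cocycles_iff)
qed

end

locale short_exact_sequence = i: cochain_map A B i + p: cochain_map B Q p
  for A :: "'c cochain_complex" and B :: "'d cochain_complex" and Q :: "'e cochain_complex" and i p +
  assumes inj: "inj_on (i n) (carrier (grp A n))"
    and surj: "p n ` carrier (grp B n) = carrier (grp Q n)"
    and exact: "i n ` carrier (grp A n) = kernel (grp B n) (grp Q n) (p n)"
begin

text \<open>
  The value is independent of the lift \<open>b\<close>: if \<open>p b'\<close> and \<open>p b\<close> are cohomologous, then after lifting the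
  cobounding element along \<open>p\<close> to \<open>t\<close>, the element \<open>b' - b - d t\<close> lies in the kernel of \<open>p\<close>, so it comes from
  some \<open>x\<close> of \<open>A\<close>, and \<open>a' - a = d x\<close>.
\<close>

lemma connecting_hom_class:
  assumes b: "b \<in> carrier (grp B n)" and a: "a \<in> carrier (grp A (n + 1))"
    and ia: "i (n + 1) a = dif B n b"
  shows "connecting_hom A B i p n (cohomology_class Q n (p n b)) = cohomology_class A (n + 1) a"
  unfolding connecting_hom_def
proof (rule the_equality)
  have cyc: "a \<in> cocycles A (n + 1)" "p n b \<in> cocycles Q n"
    if "b \<in> carrier (grp B n)" "a \<in> carrier (grp A (n + 1))" "i (n + 1) a = dif B n b" for a b
  proof -
    have "i (n + 1 + 1) (dif A (n + 1) a) = i (n + 1 + 1) \<one>\<^bsub>grp A (n + 1 + 1)\<^esub>"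
      using that by (simp only: i.map_dif i.map.hom_one i.D.dif_dif_Suc)
    then have "dif A (n + 1) a = \<one>\<^bsub>grp A (n + 1 + 1)\<^esub>"
      by (rule inj_onD[OF inj]) (use that i.C.dif.hom_closed[of a "n + 1"] in simp_all)
    then show "a \<in> cocycles A (n + 1)" using that by (simp add: i.C.cocycles_iff)
    have "i (n + 1) a \<in> kernel (grp B (n + 1)) (grp Q (n + 1)) (p (n + 1))"
      using that(2) exact by blast
    then have "p (n + 1) (dif B n b) = \<one>\<^bsub>grp Q (n + 1)\<^esub>"
      using that by (simp add: kernel_def)
    then show "p n b \<in> cocycles Q n"
      using that p.map_dif[of b n] by (simp add: p.D.cocycles_iff)
  qed
  show "\<exists>b'\<in>carrier (grp B n). \<exists>a'\<in>carrier (grp A (n + 1)).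
      p n b' \<in> cohomology_class Q n (p n b) \<and> i (n + 1) a' = dif B n b' \<and>
      cohomology_class A (n + 1) a = cohomology_class A (n + 1) a'"
    using assms cyc(2) p.D.cohomology_class_self by blast
  fix c' assume "\<exists>b'\<in>carrier (grp B n). \<exists>a'\<in>carrier (grp A (n + 1)).
      p n b' \<in> cohomology_class Q n (p n b) \<and> i (n + 1) a' = dif B n b' \<and>
      c' = cohomology_class A (n + 1) a'"
  then obtain b' a' where b': "b' \<in> carrier (grp B n)" and a': "a' \<in> carrier (grp A (n + 1))"
    and pb': "p n b' \<in> cohomology_class Q n (p n b)" and ia': "i (n + 1) a' = dif B n b'"
    and c': "c' = cohomology_class A (n + 1) a'" by blast
  note memD = p.D.cohomology_class_memD[OF pb' cyc(2)[OF b a ia]]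
  have "p n b' \<otimes>\<^bsub>grp Q n\<^esub> inv\<^bsub>grp Q n\<^esub> p n b \<in> coboundaries Q n"
    using memD cyc(2)[OF b a ia] p.D.cohomology_class_eq_iff by blast
  then obtain t' where t': "t' \<in> carrier (grp Q (n - 1))"
      "p n b' \<otimes>\<^bsub>grp Q n\<^esub> inv\<^bsub>grp Q n\<^esub> p n b = dif Q (n - 1) t'"
    by (auto simp: coboundaries_def)
  then obtain t where t: "t \<in> carrier (grp B (n - 1))" "t' = p (n - 1) t"
    using surj[of "n - 1"] by blast
  let ?d = "dif B (n - 1) t"
  have d: "?d \<in> carrier (grp B n)" using t by (simp add: i.D.dif_closed_pred)
  define e where "e = (b' \<otimes>\<^bsub>grp B n\<^esub> inv\<^bsub>grp B n\<^esub> b) \<otimes>\<^bsub>grp B n\<^esub> inv\<^bsub>grp B n\<^esub> ?d"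
  have "p n e = \<one>\<^bsub>grp Q n\<^esub>"
    using b b' t t' d by (simp add: e_def flip: p.map_dif_pred)
  moreover have "e \<in> carrier (grp B n)" using b b' d by (simp add: e_def)
  ultimately have "e \<in> kernel (grp B n) (grp Q n) (p n)" by (simp add: kernel_def)
  then obtain x where x: "x \<in> carrier (grp A n)" "e = i n x"
    unfolding exact[symmetric] by blast
  have dx: "dif A n x \<in> carrier (grp A (n + 1))" using x by simp
  have "i (n + 1) (dif A n x) = dif B n e" using x by (simp add: i.map_dif)
  also have "\<dots> = i (n + 1) (a' \<otimes>\<^bsub>grp A (n + 1)\<^esub> inv\<^bsub>grp A (n + 1)\<^esub> a)"
    using b b' d t a a' by (simp add: e_def ia ia' i.D.dif_dif)
  finally have "dif A n x = a' \<otimes>\<^bsub>grp A (n + 1)\<^esub> inv\<^bsub>grp A (n + 1)\<^esub> a"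
    by (rule inj_onD[OF inj]) (use dx a a' in simp_all)
  then have "a' \<otimes>\<^bsub>grp A (n + 1)\<^esub> inv\<^bsub>grp A (n + 1)\<^esub> a \<in> coboundaries A (n + 1)"
    using x by (auto simp: coboundaries_def simp flip: \<open>dif A n x = _\<close>)
  then show "c' = cohomology_class A (n + 1) a"
    using cyc(1)[OF b a ia] cyc(1)[OF b' a' ia'] c' i.C.cohomology_class_eq_iff by blast
qed

end

section \<open>Complete filtrations with acyclic quotients\<close>

lemma (in comm_group) div_mult_eq:
  "x \<in> carrier G \<Longrightarrow> y \<in> carrier G \<Longrightarrow> z \<in> carrier G \<Longrightarrow> x \<otimes> inv (y \<otimes> z) = (x \<otimes> inv y) \<otimes> inv z"
  by (simp add: inv_mult m_assoc)

lemma (in comm_group) mult_div_cancel: "x \<in> carrier G \<Longrightarrow> y \<in> carrier G \<Longrightarrow> (x \<otimes> y) \<otimes> inv y = x"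
  by (simp add: m_assoc)

lemma (in comm_group) div_mult_cancel: "x \<in> carrier G \<Longrightarrow> y \<in> carrier G \<Longrightarrow> (x \<otimes> inv y) \<otimes> y = x"
  by (simp add: m_assoc)

text \<open>
  The axioms \<open>separated\<close> and \<open>complete\<close> express that \<open>S\<close> is the inverse limit of the quotients \<open>S / K k\<close>.
  The axiom \<open>quotient_acyclic\<close> says, in terms of representatives, that \<open>K (k - 1) / K k\<close> has
  cohomology in degree \<open>k\<close> only.
\<close>

locale complete_filtration = complex S for S :: "'c cochain_complex" +
  fixes K :: "int \<Rightarrow> int \<Rightarrow> 'c set"
  assumes subgroup_K: "subgroup (K k n) (grp S n)"
    and K_antimono: "k \<le> l \<Longrightarrow> K l n \<subseteq> K k n"
    and dif_K: "x \<in> K k n \<Longrightarrow> dif S n x \<in> K k (n + 1)"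
    and K_negative: "k < 0 \<Longrightarrow> K k n = carrier (grp S n)"
    and separated: "x \<in> carrier (grp S n) \<Longrightarrow> (\<And>k. x \<in> K k n) \<Longrightarrow> x = \<one>\<^bsub>grp S n\<^esub>"
    and complete: "(\<And>j. u j \<in> carrier (grp S n)) \<Longrightarrow>
        (\<And>j :: nat. u (Suc j) \<otimes>\<^bsub>grp S n\<^esub> inv\<^bsub>grp S n\<^esub> u j \<in> K (k + int j) n) \<Longrightarrow>
        \<exists>x \<in> carrier (grp S n). \<forall>j. x \<otimes>\<^bsub>grp S n\<^esub> inv\<^bsub>grp S n\<^esub> u j \<in> K (k + int j) n"
    and quotient_acyclic: "s \<in> K (k - 1) i \<Longrightarrow> dif S i s \<in> K k (i + 1) \<Longrightarrow> i \<noteq> k \<Longrightarrow>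
        \<exists>t \<in> K (k - 1) (i - 1). s \<otimes>\<^bsub>grp S i\<^esub> inv\<^bsub>grp S i\<^esub> dif S (i - 1) t \<in> K k i"
begin

lemma K_carrier: "x \<in> K k n \<Longrightarrow> x \<in> carrier (grp S n)"
  by (rule subgroup.mem_carrier[OF subgroup_K])

lemma K_mono: "x \<in> K l n \<Longrightarrow> k \<le> l \<Longrightarrow> x \<in> K k n"
  using K_antimono by blast

lemma K_mult: "x \<in> K k n \<Longrightarrow> y \<in> K k n \<Longrightarrow> x \<otimes>\<^bsub>grp S n\<^esub> y \<in> K k n"
  by (rule subgroup.m_closed[OF subgroup_K])

lemma K_inv: "x \<in> K k n \<Longrightarrow> inv\<^bsub>grp S n\<^esub> x \<in> K k n"
  by (rule subgroup.m_inv_closed[OF subgroup_K])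

lemma K_one: "\<one>\<^bsub>grp S n\<^esub> \<in> K k n"
  by (rule subgroup.one_closed[OF subgroup_K])

lemma dif_K_pred: "x \<in> K k (n - 1) \<Longrightarrow> dif S (n - 1) x \<in> K k n"
  using dif_K[of x k "n - 1"] by simp

text \<open>
  A primitive of \<open>s\<close> is found by successive approximation. If \<open>s - d t\<close> already lies in \<open>K (k + j)\<close>, its class
  in the next graded piece vanishes because that piece lives in degree \<open>k + j + 1 > n\<close>, and
  correcting \<open>t\<close> by some \<open>w\<close> in \<open>K (k + j)\<close> moves \<open>s - d t\<close> into \<open>K (k + j + 1)\<close>. The corrections get deeper and
  deeper, so the approximations converge.
\<close>

lemma K_acyclic_below:
  assumes s: "s \<in> K k n" "dif S n s = \<one>\<^bsub>grp S (n + 1)\<^esub>" and "n \<le> k"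
  shows "\<exists>t \<in> K k (n - 1). dif S (n - 1) t = s"
proof -
  let ?d = "\<lambda>t. s \<otimes>\<^bsub>grp S n\<^esub> inv\<^bsub>grp S n\<^esub> dif S (n - 1) t"
  let ?P = "\<lambda>j t. t \<in> K k (n - 1) \<and> ?d t \<in> K (k + int j) n"
  have sc: "s \<in> carrier (grp S n)" using s by (simp add: K_carrier)
  have "\<exists>u. \<forall>j. ?P j (u j) \<and> u (Suc j) \<otimes>\<^bsub>grp S (n - 1)\<^esub> inv\<^bsub>grp S (n - 1)\<^esub> u j \<in> K (k + int j) (n - 1)"
  proof (rule dependent_nat_choice)
    show "\<exists>t. ?P 0 t"
      using s sc by (intro exI[of _ "\<one>\<^bsub>grp S (n - 1)\<^esub>"]) (simp add: K_one dif_one_pred)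
    fix t j assume t: "?P j t"
    then have tc: "t \<in> carrier (grp S (n - 1))" by (blast intro: K_carrier)
    have "dif S n (?d t) = \<one>\<^bsub>grp S (n + 1)\<^esub>"
      using sc tc s by (simp add: dif_closed_pred dif_dif)
    then have "\<exists>w \<in> K (k + int j) (n - 1).
        ?d t \<otimes>\<^bsub>grp S n\<^esub> inv\<^bsub>grp S n\<^esub> dif S (n - 1) w \<in> K (k + int j + 1) n"
      using quotient_acyclic[of "?d t" "k + int j + 1" n] t \<open>n \<le> k\<close> by (simp add: K_one)
    then obtain w where w: "w \<in> K (k + int j) (n - 1)"
        "?d t \<otimes>\<^bsub>grp S n\<^esub> inv\<^bsub>grp S n\<^esub> dif S (n - 1) w \<in> K (k + int j + 1) n" by blast
    have wc: "w \<in> carrier (grp S (n - 1))" "w \<in> K k (n - 1)"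
      using w by (auto intro: K_carrier K_mono)
    let ?t = "w \<otimes>\<^bsub>grp S (n - 1)\<^esub> t"
    have "?d ?t = ?d t \<otimes>\<^bsub>grp S n\<^esub> inv\<^bsub>grp S n\<^esub> dif S (n - 1) w"
      using tc wc sc by (simp add: dif_mult_pred dif_closed_pred grp.inv_mult grp.m_ac)
    then have "?P (Suc j) ?t"
      using w wc t by (simp add: K_mult algebra_simps)
    moreover have "?t \<otimes>\<^bsub>grp S (n - 1)\<^esub> inv\<^bsub>grp S (n - 1)\<^esub> t \<in> K (k + int j) (n - 1)"
      using w wc tc by (simp add: grp.mult_div_cancel)
    ultimately show "\<exists>t'. ?P (Suc j) t' \<and>
        t' \<otimes>\<^bsub>grp S (n - 1)\<^esub> inv\<^bsub>grp S (n - 1)\<^esub> t \<in> K (k + int j) (n - 1)" by blast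
  qed
  then obtain u where u: "\<And>j. u j \<in> K k (n - 1)" "\<And>j. ?d (u j) \<in> K (k + int j) n"
    "\<And>j. u (Suc j) \<otimes>\<^bsub>grp S (n - 1)\<^esub> inv\<^bsub>grp S (n - 1)\<^esub> u j \<in> K (k + int j) (n - 1)"
    by blast
  have uc: "u j \<in> carrier (grp S (n - 1))" for j using u(1) by (rule K_carrier)
  obtain x where x: "x \<in> carrier (grp S (n - 1))"
    "\<And>j. x \<otimes>\<^bsub>grp S (n - 1)\<^esub> inv\<^bsub>grp S (n - 1)\<^esub> u j \<in> K (k + int j) (n - 1)"
    using complete[OF uc u(3)] by blast
  have "x \<in> K k (n - 1)"
    using K_mult[OF x(2)[of 0, simplified] u(1)[of 0]] x(1) uc by (simp add: grp.div_mult_cancel)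
  moreover have "?d x = \<one>\<^bsub>grp S n\<^esub>"
  proof (rule separated)
    show "?d x \<in> carrier (grp S n)" using sc x by (simp add: dif_closed_pred)
    fix l
    \<comment> \<open>The approximation \<open>u j\<close> is good enough to decide membership in \<open>K l\<close>.\<close>
    define j where "j = nat (l - k)"
    let ?y = "x \<otimes>\<^bsub>grp S (n - 1)\<^esub> inv\<^bsub>grp S (n - 1)\<^esub> u j"
    have yc: "?y \<in> carrier (grp S (n - 1))" using x uc by simp
    have "?d x = ?d (?y \<otimes>\<^bsub>grp S (n - 1)\<^esub> u j)" using x uc by (simp add: grp.div_mult_cancel)
    also have "\<dots> = ?d (u j) \<otimes>\<^bsub>grp S n\<^esub> inv\<^bsub>grp S n\<^esub> dif S (n - 1) ?y"
      using yc uc sc by (simp add: dif_mult_pred dif_closed_pred grp.inv_mult grp.m_ac del: grp.m_closed grp.inv_closed)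
    also have "\<dots> \<in> K (k + int j) n"
      by (intro K_mult u K_inv dif_K_pred x)
    finally show "?d x \<in> K l n"
      by (rule K_mono) (simp add: j_def)
  qed
  then have "dif S (n - 1) x = s"
    using sc x grp.inv_solve_right[of "\<one>\<^bsub>grp S n\<^esub>" n s "dif S (n - 1) x"] by (simp add: dif_closed_pred)
  ultimately show ?thesis by blast
qed

text \<open>
  Cocycles of \<open>S / K k\<close> in degrees above \<open>k\<close> are coboundaries. The induction starts at \<open>k = -1\<close>, where the
  quotient is trivial; each step raises \<open>k\<close> by one and uses that the graded piece thus added has no
  cohomology in degree \<open>m\<close>.
\<close>

lemma coboundary_mod_K:
  assumes t: "t \<in> carrier (grp S m)" "dif S m t \<in> K k (m + 1)" and "k < m"
  shows "\<exists>w \<in> carrier (grp S (m - 1)). t \<otimes>\<^bsub>grp S m\<^esub> inv\<^bsub>grp S m\<^esub> dif S (m - 1) w \<in> K k m"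
proof (cases "k < 0")
  case True
  then show ?thesis
    using t by (intro bexI[of _ "\<one>\<^bsub>grp S (m - 1)\<^esub>"]) (simp_all add: K_negative dif_one_pred)
next
  case False
  then have "-1 \<le> k" by simp
  then show ?thesis using t(2) \<open>k < m\<close>
  proof (induction k rule: int_ge_induct)
    case base
    then show ?case
      using t by (intro bexI[of _ "\<one>\<^bsub>grp S (m - 1)\<^esub>"]) (simp_all add: K_negative dif_one_pred)
  next
    case (step k)
    have "dif S m t \<in> K k (m + 1)" using step.prems(1) by (rule K_mono) simp
    with step obtain w where w: "w \<in> carrier (grp S (m - 1))"
        "t \<otimes>\<^bsub>grp S m\<^esub> inv\<^bsub>grp S m\<^esub> dif S (m - 1) w \<in> K k m" by force
    let ?t = "t \<otimes>\<^bsub>grp S m\<^esub> inv\<^bsub>grp S m\<^esub> dif S (m - 1) w"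
    have "dif S m ?t = dif S m t" using t w by (simp add: dif_closed_pred dif_dif)
    then have "\<exists>v \<in> K k (m - 1). ?t \<otimes>\<^bsub>grp S m\<^esub> inv\<^bsub>grp S m\<^esub> dif S (m - 1) v \<in> K (k + 1) m"
      using quotient_acyclic[of ?t "k + 1" m] step.prems w by simp
    then obtain v where v: "v \<in> K k (m - 1)"
        "?t \<otimes>\<^bsub>grp S m\<^esub> inv\<^bsub>grp S m\<^esub> dif S (m - 1) v \<in> K (k + 1) m" by blast
    have vc: "v \<in> carrier (grp S (m - 1))" using v by (simp add: K_carrier)
    show ?case
      using v vc w t
      by (intro bexI[of _ "w \<otimes>\<^bsub>grp S (m - 1)\<^esub> v"])
        (simp_all add: dif_mult_pred grp.div_mult_eq dif_closed_pred)
  qed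
qed

end

section \<open>Comparison with the complex of graded pieces\<close>

text \<open>
  Here \<open>C\<close> is the complex formed by the degree \<open>n\<close> cohomology groups of the graded pieces \<open>K (n - 1) / K n\<close>,
  with the connecting homomorphisms as differentials, and \<open>\<gamma>\<close> sends a representative to its class. The
  complex is characterised by \<open>\<gamma>\<close> rather than constructed, so that the same argument applies to cohomology
  groups that are presented as those of pairs of skeleta.
\<close>

locale graded_filtration_model = complete_filtration S K for S :: "'c cochain_complex" and K +
  fixes C :: "'d cochain_complex" and \<gamma> :: "int \<Rightarrow> 'c \<Rightarrow> 'd"
  assumes comm_group_graded: "comm_group (grp C n)"
    and \<gamma>_hom: "\<gamma> n \<in> hom ((grp S n)\<lparr>carrier := {s \<in> K (n - 1) n. dif S n s \<in> K n (n + 1)}\<rparr>) (grp C n)"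
    and \<gamma>_surj: "\<gamma> n ` {s \<in> K (n - 1) n. dif S n s \<in> K n (n + 1)} = carrier (grp C n)"
    and \<gamma>_eq_one_iff: "s \<in> K (n - 1) n \<Longrightarrow> dif S n s \<in> K n (n + 1) \<Longrightarrow>
        \<gamma> n s = \<one>\<^bsub>grp C n\<^esub> \<longleftrightarrow>
        (\<exists>u \<in> K (n - 1) (n - 1). s \<otimes>\<^bsub>grp S n\<^esub> inv\<^bsub>grp S n\<^esub> dif S (n - 1) u \<in> K n n)"
    and dif_\<gamma>: "s \<in> K (n - 1) n \<Longrightarrow> dif S n s \<in> K n (n + 1) \<Longrightarrow> dif C n (\<gamma> n s) = \<gamma> (n + 1) (dif S n s)"
begin

text \<open>
  Representatives of the degree \<open>n\<close> cocycles of \<open>K (n - 1) / K n\<close>.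
\<close>

definition Z where "Z n = {s \<in> K (n - 1) n. dif S n s \<in> K n (n + 1)}"

lemma Z_iff: "s \<in> Z n \<longleftrightarrow> s \<in> K (n - 1) n \<and> dif S n s \<in> K n (n + 1)"
  by (simp add: Z_def)

lemma Z_carrier: "s \<in> Z n \<Longrightarrow> s \<in> carrier (grp S n)"
  by (auto simp: Z_iff K_carrier)

lemma Z_mult: "s \<in> Z n \<Longrightarrow> t \<in> Z n \<Longrightarrow> s \<otimes>\<^bsub>grp S n\<^esub> t \<in> Z n"
  using Z_carrier[of s n] Z_carrier[of t n] by (simp add: Z_iff K_mult)

lemma Z_inv: "s \<in> Z n \<Longrightarrow> inv\<^bsub>grp S n\<^esub> s \<in> Z n"
  using Z_carrier[of s n] by (simp add: Z_iff K_inv)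

lemma dif_Z: "s \<in> Z n \<Longrightarrow> dif S n s \<in> Z (n + 1)"
  using Z_carrier[of s n] dif_dif_Suc[of s n] K_one[of "n + 1 + 1" "n + 1"] by (simp add: Z_iff del: add.assoc)

lemma K_subset_Z: "s \<in> K n n \<Longrightarrow> s \<in> Z n"
  by (auto simp: Z_iff dif_K intro: K_mono)

lemma \<gamma>_closed: "s \<in> Z n \<Longrightarrow> \<gamma> n s \<in> carrier (grp C n)"
  using \<gamma>_surj by (force simp: Z_def)

lemma \<gamma>_mult: "s \<in> Z n \<Longrightarrow> t \<in> Z n \<Longrightarrow> \<gamma> n (s \<otimes>\<^bsub>grp S n\<^esub> t) = \<gamma> n s \<otimes>\<^bsub>grp C n\<^esub> \<gamma> n t"
  using \<gamma>_hom[of n] by (auto simp: Z_def hom_def)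

lemma \<gamma>_lift: "c \<in> carrier (grp C n) \<Longrightarrow> \<exists>s \<in> Z n. c = \<gamma> n s"
  unfolding \<gamma>_surj[symmetric] Z_def by blast

lemma \<gamma>_K: assumes "s \<in> K n n" shows "\<gamma> n s = \<one>\<^bsub>grp C n\<^esub>"
proof -
  have "\<exists>u \<in> K (n - 1) (n - 1). s \<otimes>\<^bsub>grp S n\<^esub> inv\<^bsub>grp S n\<^esub> dif S (n - 1) u \<in> K n n"
    using assms by (intro bexI[of _ "\<one>\<^bsub>grp S (n - 1)\<^esub>"]) (simp_all add: dif_one_pred K_one K_carrier)
  then show ?thesis
    using \<gamma>_eq_one_iff K_subset_Z[OF assms] by (simp add: Z_iff)
qed

text \<open>
  All properties of the differential are inherited from that of \<open>S\<close> because \<open>\<gamma>\<close> is onto and commutes with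
  the differentials.
\<close>

lemma complex_graded_pieces: "complex C"
proof (rule complex.intro)
  show "comm_group (grp C n)" for n by (rule comm_group_graded)
  show "dif C n \<in> hom (grp C n) (grp C (n + 1))" for n
  proof (rule homI)
    fix c assume "c \<in> carrier (grp C n)"
    then obtain s where "s \<in> Z n" "c = \<gamma> n s" using \<gamma>_lift by blast
    then show "dif C n c \<in> carrier (grp C (n + 1))"
      using dif_\<gamma> \<gamma>_closed[OF dif_Z] by (simp add: Z_iff)
  next
    fix c c' assume "c \<in> carrier (grp C n)" "c' \<in> carrier (grp C n)"
    then obtain s s' where s: "s \<in> Z n" "c = \<gamma> n s" "s' \<in> Z n" "c' = \<gamma> n s'" using \<gamma>_lift by meson
    have "dif C n (c \<otimes>\<^bsub>grp C n\<^esub> c') = dif C n (\<gamma> n (s \<otimes>\<^bsub>grp S n\<^esub> s'))"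
      using s by (simp add: \<gamma>_mult)
    also have "\<dots> = \<gamma> (n + 1) (dif S n s \<otimes>\<^bsub>grp S (n + 1)\<^esub> dif S n s')"
      using s Z_mult[of s n s'] by (simp add: dif_\<gamma> Z_iff Z_carrier)
    also have "\<dots> = dif C n c \<otimes>\<^bsub>grp C (n + 1)\<^esub> dif C n c'"
      using s by (simp add: dif_\<gamma> Z_iff flip: \<gamma>_mult[OF dif_Z dif_Z])
    finally show "dif C n (c \<otimes>\<^bsub>grp C n\<^esub> c') = dif C n c \<otimes>\<^bsub>grp C (n + 1)\<^esub> dif C n c'" .
  qed
  fix c n assume "c \<in> carrier (grp C (n - 1))"
  then obtain s where s: "s \<in> Z (n - 1)" "c = \<gamma> (n - 1) s" using \<gamma>_lift by blast
  have d: "dif S (n - 1) s \<in> Z n" using dif_Z[OF s(1)] by simp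
  have "dif C n (dif C (n - 1) c) = dif C n (\<gamma> n (dif S (n - 1) s))"
    using s dif_\<gamma>[of s "n - 1"] by (simp add: Z_iff)
  also have "\<dots> = \<gamma> (n + 1) \<one>\<^bsub>grp S (n + 1)\<^esub>"
    using d s by (simp add: dif_\<gamma> Z_iff dif_dif K_carrier)
  finally show "dif C n (dif C (n - 1) c) = \<one>\<^bsub>grp C (n + 1)\<^esub>"
    by (simp add: \<gamma>_K K_one)
qed

sublocale C: complex C by (rule complex_graded_pieces)

text \<open>
  The genuine cocycles among these representatives.
\<close>

definition Zc where "Zc n = {s \<in> K (n - 1) n. dif S n s = \<one>\<^bsub>grp S (n + 1)\<^esub>}"

lemma Zc_subset: "s \<in> Zc n \<Longrightarrow> s \<in> Z n"
  by (simp add: Zc_def Z_iff K_one)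

lemma Zc_cocycle: "s \<in> Zc n \<Longrightarrow> s \<in> cocycles S n"
  by (auto simp: Zc_def cocycles_iff intro: K_carrier)

lemma Zc_carrier: "s \<in> Zc n \<Longrightarrow> s \<in> carrier (grp S n)"
  by (auto simp: Zc_def intro: K_carrier)

lemma subgroup_Zc: "subgroup (Zc n) (grp S n)"
  by (intro subgroup.intro) (auto simp: Zc_def K_carrier K_one K_mult K_inv)

lemma Zc_mult: "s \<in> Zc n \<Longrightarrow> t \<in> Zc n \<Longrightarrow> s \<otimes>\<^bsub>grp S n\<^esub> t \<in> Zc n"
  by (rule subgroup.m_closed[OF subgroup_Zc])

lemma \<gamma>_cocycle: "s \<in> Zc n \<Longrightarrow> \<gamma> n s \<in> cocycles C n"
  by (simp add: C.cocycles_iff \<gamma>_closed Zc_subset) (simp add: Zc_def dif_\<gamma> K_one \<gamma>_K)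

lemma class_\<gamma>_hom:
  "(\<lambda>s. cohomology_class C n (\<gamma> n s)) \<in> hom ((grp S n)\<lparr>carrier := Zc n\<rparr>) (cohomology C n)"
  using C.cohomology_class_hom[of n] by (auto simp: hom_def \<gamma>_cocycle \<gamma>_mult Zc_subset)

text \<open>
  From left to right, if \<open>\<gamma> s\<close> is the coboundary of \<open>\<gamma> t\<close>, then \<open>s - d t - d u\<close> is a cocycle in \<open>K n\<close> for some \<open>u\<close>,
  hence a coboundary by \<open>K_acyclic_below\<close>. Conversely, if \<open>s = d t\<close> lies in \<open>K (n - 1)\<close>, then \<open>t\<close> is a cocycle modulo
  \<open>K (n - 2)\<close> and, by \<open>coboundary_mod_K\<close>, may be changed by a coboundary so as to lie in \<open>K (n - 2)\<close>; now \<open>\<gamma> t\<close> is defined.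
\<close>

lemma class_\<gamma>_eq_one_iff:
  assumes s: "s \<in> Zc n"
  shows "cohomology_class C n (\<gamma> n s) = \<one>\<^bsub>cohomology C n\<^esub> \<longleftrightarrow> s \<in> coboundaries S n"
proof
  have sc: "s \<in> carrier (grp S n)" using s by (rule Zc_carrier)
  assume "cohomology_class C n (\<gamma> n s) = \<one>\<^bsub>cohomology C n\<^esub>"
  then have "\<gamma> n s \<in> coboundaries C n"
    by (simp add: C.cohomology_class_eq_one_iff \<gamma>_cocycle s)
  then obtain t where t: "t \<in> Z (n - 1)" "\<gamma> n s = dif C (n - 1) (\<gamma> (n - 1) t)"
    unfolding coboundaries_def using \<gamma>_lift by fastforce
  let ?dt = "dif S (n - 1) t"
  have tc: "t \<in> carrier (grp S (n - 1))" using t by (simp add: Z_carrier)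
  have dt: "?dt \<in> Z n" using dif_Z[OF t(1)] by simp
  have sdt: "s \<otimes>\<^bsub>grp S n\<^esub> inv\<^bsub>grp S n\<^esub> ?dt \<in> Z n"
    using dt Zc_subset[OF s] by (simp add: Z_mult Z_inv)
  have "\<gamma> n s = \<gamma> n ?dt" using t dif_\<gamma>[of t "n - 1"] by (simp add: Z_iff)
  moreover have "\<gamma> n s = \<gamma> n (s \<otimes>\<^bsub>grp S n\<^esub> inv\<^bsub>grp S n\<^esub> ?dt) \<otimes>\<^bsub>grp C n\<^esub> \<gamma> n ?dt"
    using sc dt sdt by (simp add: Z_carrier grp.div_mult_cancel flip: \<gamma>_mult)
  ultimately have "\<gamma> n (s \<otimes>\<^bsub>grp S n\<^esub> inv\<^bsub>grp S n\<^esub> ?dt) = \<one>\<^bsub>grp C n\<^esub>"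
    using \<gamma>_closed[OF dt] \<gamma>_closed[OF sdt] by (simp add: C.grp.l_cancel_one)
  then obtain u where u: "u \<in> K (n - 1) (n - 1)"
    "s \<otimes>\<^bsub>grp S n\<^esub> inv\<^bsub>grp S n\<^esub> ?dt \<otimes>\<^bsub>grp S n\<^esub> inv\<^bsub>grp S n\<^esub> dif S (n - 1) u \<in> K n n" (is "?v \<in> _")
    using \<gamma>_eq_one_iff sdt by (auto simp: Z_iff)
  have uc: "u \<in> carrier (grp S (n - 1))" using u by (simp add: K_carrier)
  have "dif S n ?v = \<one>\<^bsub>grp S (n + 1)\<^esub>"
    using s sc uc tc by (simp add: dif_closed_pred dif_dif Zc_def)
  then obtain w where w: "w \<in> K n (n - 1)" "dif S (n - 1) w = ?v"
    using K_acyclic_below[OF u(2)] by blast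
  have wc: "w \<in> carrier (grp S (n - 1))" using w by (simp add: K_carrier)
  have "s = ?v \<otimes>\<^bsub>grp S n\<^esub> dif S (n - 1) u \<otimes>\<^bsub>grp S n\<^esub> ?dt"
    using sc uc tc by (simp add: grp.div_mult_cancel dif_closed_pred)
  also have "\<dots> = dif S (n - 1) (w \<otimes>\<^bsub>grp S (n - 1)\<^esub> u \<otimes>\<^bsub>grp S (n - 1)\<^esub> t)"
    using wc uc tc by (simp add: dif_mult_pred w)
  finally show "s \<in> coboundaries S n"
    using wc uc tc unfolding coboundaries_def by blast
next
  assume "s \<in> coboundaries S n"
  then obtain t where t: "t \<in> carrier (grp S (n - 1))" "s = dif S (n - 1) t"
    by (auto simp: coboundaries_def)
  \<comment> \<open>Move \<open>t\<close> into \<open>K (n - 2)\<close> without changing its differential.\<close>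
  have "dif S (n - 1) t \<in> K (n - 2) n" using s t by (auto simp: Zc_def intro: K_mono)
  then obtain w where w: "w \<in> carrier (grp S (n - 1 - 1))"
      "t \<otimes>\<^bsub>grp S (n - 1)\<^esub> inv\<^bsub>grp S (n - 1)\<^esub> dif S (n - 1 - 1) w \<in> K (n - 2) (n - 1)" (is "?t \<in> _")
    using coboundary_mod_K[OF t(1), of "n - 2"] by auto
  have dwc: "dif S (n - 1 - 1) w \<in> carrier (grp S (n - 1))" using w dif_closed_pred by blast
  have "dif S (n - 1) (dif S (n - 1 - 1) w) = \<one>\<^bsub>grp S n\<^esub>" using dif_dif[OF w(1)] by simp
  then have dt: "dif S (n - 1) ?t = s"
    using t dwc by (simp add: dif_mult_pred dif_inv_pred dif_closed_pred)
  have tZ: "?t \<in> Z (n - 1)" using w(2) s dt by (simp add: Z_iff Zc_def)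
  then have "\<gamma> n s = dif C (n - 1) (\<gamma> (n - 1) ?t)"
    using dif_\<gamma>[of ?t "n - 1"] dt by (simp add: Z_iff)
  then have "\<gamma> n s \<in> coboundaries C n"
    using \<gamma>_closed[OF tZ] by (simp add: coboundaries_def)
  then show "cohomology_class C n (\<gamma> n s) = \<one>\<^bsub>cohomology C n\<^esub>"
    by (simp add: C.cohomology_class_eq_one_iff \<gamma>_cocycle s)
qed

lemma cohomology_class_eq_class_in_K:
  assumes "z \<in> cocycles S n"
  shows "\<exists>s \<in> Zc n. cohomology_class S n z = cohomology_class S n s"
proof -
  have z: "z \<in> carrier (grp S n)" "dif S n z = \<one>\<^bsub>grp S (n + 1)\<^esub>" using assms by (auto simp: cocycles_iff)
  obtain w where w: "w \<in> carrier (grp S (n - 1))"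
      "z \<otimes>\<^bsub>grp S n\<^esub> inv\<^bsub>grp S n\<^esub> dif S (n - 1) w \<in> K (n - 1) n" (is "?s \<in> _")
    using coboundary_mod_K[of z n "n - 1"] z by (auto simp: K_one)
  have s: "?s \<in> Zc n"
    using w z by (simp add: Zc_def dif_closed_pred dif_dif)
  have "z \<otimes>\<^bsub>grp S n\<^esub> inv\<^bsub>grp S n\<^esub> ?s = dif S (n - 1) w"
    using w z by (simp add: dif_closed_pred grp.inv_mult grp.inv_solve_left' flip: grp.m_assoc)
  then have "cohomology_class S n z = cohomology_class S n ?s"
    using w(1) Zc_cocycle[OF s] assms by (simp add: cohomology_class_eq_iff coboundaries_def)
  then show ?thesis using s by blast
qed

text \<open>
  If \<open>\<gamma> s\<close> is a cocycle, then \<open>d s\<close> differs from some \<open>d u\<close> with \<open>u\<close> in \<open>K n\<close> by a cocycle in \<open>K (n + 1)\<close>, which is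
  \<open>d w\<close> with \<open>w\<close> in \<open>K (n + 1)\<close>. Then \<open>s - u - w\<close> is a cocycle, and \<open>\<gamma>\<close> does not see \<open>u\<close> and \<open>w\<close>.
\<close>

lemma class_\<gamma>_surj: "(\<lambda>s. cohomology_class C n (\<gamma> n s)) ` Zc n = carrier (cohomology C n)"
proof
  show "(\<lambda>s. cohomology_class C n (\<gamma> n s)) ` Zc n \<subseteq> carrier (cohomology C n)"
    by (auto simp: C.carrier_cohomology \<gamma>_cocycle)
  have "cohomology_class C n c \<in> (\<lambda>s. cohomology_class C n (\<gamma> n s)) ` Zc n"
    if "c \<in> cocycles C n" for c
  proof -
    from that have "c \<in> carrier (grp C n)" "dif C n c = \<one>\<^bsub>grp C (n + 1)\<^esub>" by (auto simp: C.cocycles_iff)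
    then obtain s where s: "s \<in> Z n" "c = \<gamma> n s" "dif C n (\<gamma> n s) = \<one>\<^bsub>grp C (n + 1)\<^esub>"
      using \<gamma>_lift by blast
    have sc: "s \<in> carrier (grp S n)" using s by (simp add: Z_carrier)
    have "\<gamma> (n + 1) (dif S n s) = \<one>\<^bsub>grp C (n + 1)\<^esub>" using s by (simp add: dif_\<gamma> Z_iff)
    then have "\<exists>u \<in> K n n.
        dif S n s \<otimes>\<^bsub>grp S (n + 1)\<^esub> inv\<^bsub>grp S (n + 1)\<^esub> dif S n u \<in> K (n + 1) (n + 1)"
      using \<gamma>_eq_one_iff[of "dif S n s" "n + 1"] dif_Z[OF s(1)] by (simp add: Z_iff)
    then obtain u where u: "u \<in> K n n"
        "dif S n s \<otimes>\<^bsub>grp S (n + 1)\<^esub> inv\<^bsub>grp S (n + 1)\<^esub> dif S n u \<in> K (n + 1) (n + 1)" (is "?v \<in> _")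
      by blast
    have uc: "u \<in> carrier (grp S n)" using u by (simp add: K_carrier)
    have "dif S (n + 1) ?v = \<one>\<^bsub>grp S (n + 1 + 1)\<^esub>"
      using sc uc by (simp add: dif_dif_Suc del: add.assoc)
    then obtain w where w: "w \<in> K (n + 1) n" "dif S n w = ?v"
      using K_acyclic_below[OF u(2)] by auto
    have wc: "w \<in> carrier (grp S n)" using w by (simp add: K_carrier)
    have wK: "w \<in> K n n" using w by (auto intro: K_mono)
    let ?s = "s \<otimes>\<^bsub>grp S n\<^esub> inv\<^bsub>grp S n\<^esub> u \<otimes>\<^bsub>grp S n\<^esub> inv\<^bsub>grp S n\<^esub> w"
    have "?s \<in> Z n"
      using s u wK by (simp add: Z_mult Z_inv K_subset_Z)
    moreover have "dif S n ?s = \<one>\<^bsub>grp S (n + 1)\<^esub>"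
      using sc uc wc w(2) by simp
    ultimately have s': "?s \<in> Zc n" by (simp add: Z_iff Zc_def)
    have "s = ?s \<otimes>\<^bsub>grp S n\<^esub> w \<otimes>\<^bsub>grp S n\<^esub> u"
      using sc uc wc by (simp add: grp.div_mult_cancel)
    then have "\<gamma> n s = \<gamma> n (?s \<otimes>\<^bsub>grp S n\<^esub> w \<otimes>\<^bsub>grp S n\<^esub> u)" by (rule arg_cong)
    also have "\<dots> = \<gamma> n ?s \<otimes>\<^bsub>grp C n\<^esub> \<gamma> n w \<otimes>\<^bsub>grp C n\<^esub> \<gamma> n u"
      using Z_mult[OF \<open>?s \<in> Z n\<close> K_subset_Z[OF wK]] \<open>?s \<in> Z n\<close> K_subset_Z[OF wK] K_subset_Z[OF u(1)]
      by (simp only: \<gamma>_mult)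
    finally have "\<gamma> n s = \<gamma> n ?s"
      using \<gamma>_closed[OF \<open>?s \<in> Z n\<close>] by (simp add: \<gamma>_K wK u)
    then have "cohomology_class C n c = cohomology_class C n (\<gamma> n ?s)" by (simp only: s(2))
    then show ?thesis using s' by (rule image_eqI)
  qed
  then show "carrier (cohomology C n) \<subseteq> (\<lambda>s. cohomology_class C n (\<gamma> n s)) ` Zc n"
    by (auto simp: C.carrier_cohomology)
qed

text \<open>
  The map \<open>\<gamma>\<close> is meaningful only on cochains in \<open>K (n - 1)\<close>, so that only such representatives of the
  class \<open>c\<close> are admitted.
\<close>

definition comparison where
  "comparison n c = (THE c'. \<exists>s \<in> c \<inter> K (n - 1) n. c' = cohomology_class C n (\<gamma> n s))"

lemma comparison_class:
  assumes s: "s \<in> Zc n"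
  shows "comparison n (cohomology_class S n s) = cohomology_class C n (\<gamma> n s)"
  unfolding comparison_def
proof (rule the_equality)
  show "\<exists>s'\<in>cohomology_class S n s \<inter> K (n - 1) n.
      cohomology_class C n (\<gamma> n s) = cohomology_class C n (\<gamma> n s')"
  proof (rule bexI[of _ s])
    show "s \<in> cohomology_class S n s \<inter> K (n - 1) n"
      using s cohomology_class_self[OF Zc_cocycle[OF s]] unfolding Zc_def by blast
  qed (rule refl)
  fix c' assume "\<exists>s'\<in>cohomology_class S n s \<inter> K (n - 1) n. c' = cohomology_class C n (\<gamma> n s')"
  then obtain s' where s': "s' \<in> cohomology_class S n s" "s' \<in> K (n - 1) n"
    "c' = cohomology_class C n (\<gamma> n s')" by blast
  note D = cohomology_class_memD[OF s'(1) Zc_cocycle[OF s]]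
  have s'c: "s' \<in> Zc n" using D(1) s'(2) by (simp add: Zc_def cocycles_iff)
  let ?q = "s' \<otimes>\<^bsub>grp S n\<^esub> inv\<^bsub>grp S n\<^esub> s"
  have q: "?q \<in> Zc n"
    using s s'c by (simp add: Zc_mult subgroup.m_inv_closed[OF subgroup_Zc])
  have "?q \<in> coboundaries S n"
    using D s by (simp add: cohomology_class_eq_iff Zc_cocycle)
  then have "cohomology_class C n (\<gamma> n ?q) = \<one>\<^bsub>cohomology C n\<^esub>"
    using q by (simp add: class_\<gamma>_eq_one_iff)
  moreover have "c' = cohomology_class C n (\<gamma> n (?q \<otimes>\<^bsub>grp S n\<^esub> s))"
    using s s'c s'(3) by (simp add: Zc_carrier grp.div_mult_cancel)
  ultimately have "c' = \<one>\<^bsub>cohomology C n\<^esub> \<otimes>\<^bsub>cohomology C n\<^esub> cohomology_class C n (\<gamma> n s)"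
    using hom_mult[OF class_\<gamma>_hom, of ?q n s] q s by simp
  moreover have "cohomology_class C n (\<gamma> n s) \<in> carrier (cohomology C n)"
    using s by (simp add: C.carrier_cohomology \<gamma>_cocycle)
  ultimately show "c' = cohomology_class C n (\<gamma> n s)"
    using C.comm_group_cohomology[of n] by (simp add: comm_group_def group.is_monoid monoid.l_one)
qed

lemma comparison_iso: "comparison n \<in> iso (cohomology S n) (cohomology C n)"
proof (rule iso_of_same_kernel[where G = "(grp S n)\<lparr>carrier := Zc n\<rparr>" and f = "cohomology_class S n"
      and g = "\<lambda>s. cohomology_class C n (\<gamma> n s)"])
  show "group ((grp S n)\<lparr>carrier := Zc n\<rparr>)"
    by (rule subgroup.subgroup_is_group[OF subgroup_Zc grp.is_group])
  show "group (cohomology S n)" "group (cohomology C n)"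
    using comm_group_cohomology C.comm_group_cohomology by (auto simp: comm_group_def)
  show "cohomology_class S n \<in> hom ((grp S n)\<lparr>carrier := Zc n\<rparr>) (cohomology S n)"
    using cohomology_class_hom[of n] by (auto simp: hom_def Zc_cocycle)
  show "cohomology_class S n ` carrier ((grp S n)\<lparr>carrier := Zc n\<rparr>) = carrier (cohomology S n)"
    using cohomology_class_eq_class_in_K by (auto simp: carrier_cohomology Zc_cocycle image_iff) 
qed (simp_all add: class_\<gamma>_hom class_\<gamma>_surj class_\<gamma>_eq_one_iff cohomology_class_eq_one_iff
    Zc_cocycle comparison_class)

end

section \<open>The cochain complex of a presheaf on a poset\<close>

lemma (in group_hom) hom_finprod:
  assumes "comm_group G" "comm_group H" "f \<in> A \<rightarrow> carrier G"
  shows "h (finprod G f A) = finprod H (\<lambda>i. h (f i)) A"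
proof -
  interpret G: comm_group G by fact
  interpret H: comm_group H by fact
  show ?thesis
    using assms(3)
  proof (induction A rule: infinite_finite_induct)
    case (insert a A)
    then have "f a \<in> carrier G" "f \<in> A \<rightarrow> carrier G" by auto
    moreover from this have "(\<lambda>i. h (f i)) \<in> A \<rightarrow> carrier H" by (auto simp: Pi_iff)
    ultimately show ?case using insert by simp
  qed simp_all
qed

lemma (in comm_group) int_pow_hom: "(\<lambda>x. x [^] (k :: int)) \<in> hom G G"
  by (rule homI) (simp_all add: int_pow_distrib)

lemma (in comm_group) finprod_int_pow:
  assumes "f \<in> A \<rightarrow> carrier G"
  shows "finprod G f A [^] (k :: int) = (\<Otimes>i\<in>A. f i [^] k)"
proof -
  interpret group_hom G G "\<lambda>x. x [^] k" by unfold_locales (rule int_pow_hom)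
  show ?thesis by (rule hom_finprod[OF comm_group_axioms comm_group_axioms assms])
qed

text \<open>
  The cancellation behind \<open>d\<^sup>2 = 0\<close>: the hypothesis \<open>swap\<close> is the simplicial identity, which pairs
  the entry at \<open>(i, j)\<close> for \<open>j < i\<close> with the one at \<open>(j, i - 1)\<close> of opposite sign. In the induction,
  the last row is the inverse of the last column.
\<close>

lemma (in comm_group) finprod_alternating_square:
  fixes h :: "nat \<Rightarrow> nat \<Rightarrow> 'a"
  assumes closed: "\<And>i j. i \<le> m \<Longrightarrow> j < m \<Longrightarrow> h i j \<in> carrier G"
    and swap: "\<And>i j. j < i \<Longrightarrow> i \<le> m \<Longrightarrow> h i j = h j (i - 1)"
  shows "(\<Otimes>i\<in>{..<Suc m}. \<Otimes>j\<in>{..<m}. h i j [^] ((- 1) ^ (i + j) :: int)) = \<one>"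
  using assms
proof (induction m)
  case 0
  then show ?case by simp
next
  case (Suc m)
  let ?g = "\<lambda>i j. h i j [^] ((- 1) ^ (i + j) :: int)"
  have g: "?g i j \<in> carrier G" if "i \<le> Suc m" "j < Suc m" for i j
    using Suc.prems(1) that by simp
  let ?row = "\<Otimes>j\<in>{..<Suc m}. ?g (Suc m) j"
  let ?col = "\<Otimes>i\<in>{..<Suc m}. ?g i m"
  have row: "?row \<in> carrier G" and col: "?col \<in> carrier G"
    by (intro finprod_closed Pi_I g; simp)+
  have "(\<Otimes>i\<in>{..<Suc (Suc m)}. \<Otimes>j\<in>{..<Suc m}. ?g i j)
      = ?row \<otimes> (\<Otimes>i\<in>{..<Suc m}. \<Otimes>j\<in>{..<Suc m}. ?g i j)"
    unfolding lessThan_Suc[of "Suc m"] by (rule finprod_insert; (intro finprod_closed Pi_I g)?; simp)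
  also have "(\<Otimes>i\<in>{..<Suc m}. \<Otimes>j\<in>{..<Suc m}. ?g i j)
      = (\<Otimes>i\<in>{..<Suc m}. ?g i m \<otimes> (\<Otimes>j\<in>{..<m}. ?g i j))"
  proof (rule finprod_cong')
    fix i assume "i \<in> {..<Suc m}"
    then show "(\<Otimes>j\<in>{..<Suc m}. ?g i j) = ?g i m \<otimes> (\<Otimes>j\<in>{..<m}. ?g i j)"
      unfolding lessThan_Suc[of m] by (intro finprod_insert Pi_I g) auto
  qed (auto intro!: m_closed finprod_closed Pi_I g)
  also have "\<dots> = ?col \<otimes> (\<Otimes>i\<in>{..<Suc m}. \<Otimes>j\<in>{..<m}. ?g i j)"
    by (rule finprod_multf) (auto intro!: finprod_closed Pi_I g)
  also have "(\<Otimes>i\<in>{..<Suc m}. \<Otimes>j\<in>{..<m}. ?g i j) = \<one>"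
    by (rule Suc.IH) (use Suc.prems in simp_all)
  also have "?row = inv ?col"
  proof -
    \<comment> \<open>The entry \<open>(Suc m, j)\<close> equals the entry \<open>(j, m)\<close>, and the exponents have opposite parity.\<close>
    have "?row = (\<Otimes>j\<in>{..<Suc m}. ?g j m [^] (- 1 :: int))"
    proof (rule finprod_cong')
      fix j assume "j \<in> {..<Suc m}"
      then have j: "j \<le> m" by simp
      have hc: "h j m \<in> carrier G" using Suc.prems(1) j by simp
      have "h (Suc m) j = h j m" using Suc.prems(2)[of j "Suc m"] j by simp
      then show "?g (Suc m) j = ?g j m [^] (- 1 :: int)"
        using hc by (simp add: int_pow_pow add.commute)
    qed (use g in auto)
    also have "\<dots> = ?col [^] (- 1 :: int)"
      by (rule finprod_int_pow[symmetric]) (use g in auto)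
    finally show ?thesis using col by (simp add: int_pow_neg)
  qed
  finally show ?case using col by simp
qed

lemma nerve_mono: "Q \<subseteq> P \<Longrightarrow> nerve n Q \<subseteq> nerve n P"
  by (auto simp: nerve_def)

lemma nerve_length_1: "\<sigma> \<in> nerve n P \<Longrightarrow> \<not> 2 \<le> length \<sigma> \<Longrightarrow> length \<sigma> = 1"
  by (cases \<sigma>) (auto simp: nerve_def Suc_le_eq)

lemma last_nerve: "\<sigma> \<in> nerve n P \<Longrightarrow> last \<sigma> \<in> P"
  using last_in_set by (fastforce simp: nerve_def)

lemma length_face: "i < length \<sigma> \<Longrightarrow> length (face i \<sigma>) = length \<sigma> - 1"
  by (simp add: face_def)

lemma face_nth: "i < length \<sigma> \<Longrightarrow> k < length \<sigma> - 1 \<Longrightarrow> face i \<sigma> ! k = \<sigma> ! (if k < i then k else Suc k)"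
  by (auto simp: face_def nth_append)

lemma face_nerve:
  assumes "\<sigma> \<in> nerve n P" "i < length \<sigma>" "2 \<le> length \<sigma>"
  shows "face i \<sigma> \<in> nerve (n - 1) P"
proof -
  have "sorted_wrt (\<lambda>x y. y \<le> x) (take i \<sigma> @ \<sigma> ! i # drop (Suc i) \<sigma>)"
    using assms by (simp add: nerve_def flip: id_take_nth_drop)
  then have "sorted_wrt (\<lambda>x y. y \<le> x) (face i \<sigma>)"
    by (simp add: face_def sorted_wrt_append)
  moreover have "set (face i \<sigma>) \<subseteq> P"
    using assms set_take_subset set_drop_subset by (fastforce simp: face_def nerve_def)
  moreover have "length (face i \<sigma>) = length \<sigma> - 1" using assms by (simp add: length_face)
  ultimately show ?thesis using assms by (auto simp: nerve_def of_nat_diff)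
qed

lemma face_face:
  assumes "j < i" "i < length \<sigma>"
  shows "face j (face i \<sigma>) = face (i - 1) (face j \<sigma>)"
proof (rule nth_equalityI)
  show "length (face j (face i \<sigma>)) = length (face (i - 1) (face j \<sigma>))"
    using assms by (simp add: length_face)
  fix k assume "k < length (face j (face i \<sigma>))"
  then have k: "k < length \<sigma> - 1 - 1"
    using assms by (simp add: length_face)
  have "face j (face i \<sigma>) ! k = face i \<sigma> ! (if k < j then k else Suc k)"
    by (rule face_nth) (use assms k in \<open>simp_all add: length_face\<close>)
  also have "\<dots> = \<sigma> ! (if k < j then k else if Suc k < i then Suc k else Suc (Suc k))"
    by (subst face_nth) (use assms k in auto)
  also have "\<dots> = face j \<sigma> ! (if k < i - 1 then k else Suc k)"
    by (subst face_nth) (use assms k in auto)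
  also have "\<dots> = face (i - 1) (face j \<sigma>) ! k"
    by (rule face_nth[symmetric]) (use assms k in \<open>simp_all add: length_face\<close>)
  finally show "face j (face i \<sigma>) ! k = face (i - 1) (face j \<sigma>) ! k" .
qed

lemma last_face_less:
  assumes "i < length \<sigma> - 1"
  shows "last (face i \<sigma>) = last \<sigma>"
  using assms by (simp add: face_def last_append last_drop)

lemma last_face_last:
  assumes "2 \<le> length \<sigma>"
  shows "last (face (length \<sigma> - 1) \<sigma>) = \<sigma> ! (length \<sigma> - 2)"
  using assms by (subst last_conv_nth) (auto simp: face_def min_def numeral_2_eq_2)

lemma last_nerve_le: "\<sigma> \<in> nerve n P \<Longrightarrow> x \<in> set \<sigma> \<Longrightarrow> last \<sigma> \<le> x"
  by (cases \<sigma> rule: rev_cases) (auto simp: nerve_def sorted_wrt_append)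

lemma last_le_last_face:
  assumes "\<sigma> \<in> nerve n P" "i < length \<sigma>" "2 \<le> length \<sigma>"
  shows "last \<sigma> \<le> last (face i \<sigma>)"
proof (rule last_nerve_le[OF assms(1)])
  have "face i \<sigma> \<noteq> []" using face_nerve[OF assms] by (simp add: nerve_def)
  then have "last (face i \<sigma>) \<in> set (face i \<sigma>)" by simp
  then show "last (face i \<sigma>) \<in> set \<sigma>"
    using set_take_subset[of i \<sigma>] set_drop_subset[of "Suc i" \<sigma>] by (auto simp: face_def)
qed

text \<open>
  The contribution of the \<open>i\<close>-th face to the differential, in a form that treats all faces alike: unless the last
  vertex is deleted, the restriction map is an identity.
\<close>

definition coface :: "('a, 'b) presheaf \<Rightarrow> ('a list \<Rightarrow> 'b) \<Rightarrow> 'a list \<Rightarrow> nat \<Rightarrow> 'b" where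
  "coface F s \<sigma> i = res F (last (face i \<sigma>)) (last \<sigma>) (s (face i \<sigma>))"

locale poset_presheaf =
  fixes P :: "'a::order set" and F :: "('a, 'b) presheaf"
  assumes presheaf_on: "presheaf_on P F"
begin

lemma obj_comm_group: "x \<in> P \<Longrightarrow> comm_group (obj F x)"
  using presheaf_on by (simp add: presheaf_on_def)

lemma obj_group: "x \<in> P \<Longrightarrow> group (obj F x)"
  using obj_comm_group by (simp add: comm_group_def)

lemma res_hom: "x \<in> P \<Longrightarrow> y \<in> P \<Longrightarrow> x \<le> y \<Longrightarrow> res F y x \<in> hom (obj F y) (obj F x)"
  using presheaf_on by (simp add: presheaf_on_def)

lemma res_group_hom: "x \<in> P \<Longrightarrow> y \<in> P \<Longrightarrow> x \<le> y \<Longrightarrow> group_hom (obj F y) (obj F x) (res F y x)"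
  by (simp add: group_hom_def group_hom_axioms_def obj_group res_hom)

lemma res_closed:
  "x \<in> P \<Longrightarrow> y \<in> P \<Longrightarrow> x \<le> y \<Longrightarrow> a \<in> carrier (obj F y) \<Longrightarrow> res F y x a \<in> carrier (obj F x)"
  by (rule hom_in_carrier[OF res_hom])

lemma res_id: "x \<in> P \<Longrightarrow> a \<in> carrier (obj F x) \<Longrightarrow> res F x x a = a"
  using presheaf_on by (simp add: presheaf_on_def)

lemma res_res: "x \<in> P \<Longrightarrow> y \<in> P \<Longrightarrow> z \<in> P \<Longrightarrow> x \<le> y \<Longrightarrow> y \<le> z \<Longrightarrow> a \<in> carrier (obj F z) \<Longrightarrow>
    res F y x (res F z y a) = res F z x a"
  using presheaf_on unfolding presheaf_on_def by blast

lemma poset_presheaf_subset: "Q \<subseteq> P \<Longrightarrow> poset_presheaf Q F"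
  unfolding poset_presheaf_def presheaf_on_def
  by (simp add: subset_iff obj_comm_group res_hom res_id res_res)

lemma cochain_value:
  "s \<in> carrier (grp (cochains P F) n) \<Longrightarrow> \<sigma> \<in> nerve n P \<Longrightarrow> s \<sigma> \<in> carrier (obj F (last \<sigma>))"
  by (auto simp: cochains_def)

lemma coface_closed:
  assumes "s \<in> carrier (grp (cochains P F) (n - 1))" "\<sigma> \<in> nerve n P" "i < length \<sigma>" "2 \<le> length \<sigma>"
  shows "coface F s \<sigma> i \<in> carrier (obj F (last \<sigma>))"
  unfolding coface_def
  by (rule res_closed[OF last_nerve[OF assms(2)] last_nerve[OF face_nerve[OF assms(2-4)]]
        last_le_last_face[OF assms(2-4)] cochain_value[OF assms(1) face_nerve[OF assms(2-4)]]])

lemma differential_length_1: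
  "\<sigma> \<in> nerve (n + 1) P \<Longrightarrow> length \<sigma> = 1 \<Longrightarrow> cochain_differential P F n s \<sigma> = \<one>\<^bsub>obj F (last \<sigma>)\<^esub>"
  by (cases \<sigma>) (simp_all add: cochain_differential_def Let_def)

lemma differential_eq:
  assumes s: "s \<in> carrier (grp (cochains P F) n)" and \<sigma>: "\<sigma> \<in> nerve (n + 1) P" "2 \<le> length \<sigma>"
  shows "cochain_differential P F n s \<sigma> =
    (\<Otimes>\<^bsub>obj F (last \<sigma>)\<^esub>i\<in>{..<length \<sigma>}. coface F s \<sigma> i [^]\<^bsub>obj F (last \<sigma>)\<^esub> ((- 1) ^ i :: int))"
proof -
  define m where "m = length \<sigma> - 1"
  have m: "0 < m" "length \<sigma> = Suc m" using \<sigma> by (auto simp: m_def)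
  have last: "\<sigma> ! m = last \<sigma>" using m by (metis Zero_not_Suc diff_Suc_1 last_conv_nth list.size(3))
  interpret G: comm_group "obj F (last \<sigma>)" using \<sigma> by (blast intro: obj_comm_group last_nerve)
  have closed: "coface F s \<sigma> i [^]\<^bsub>obj F (last \<sigma>)\<^esub> ((- 1) ^ i :: int) \<in> carrier (obj F (last \<sigma>))"
    if "i < Suc m" for i
    using coface_closed[of s "n + 1" \<sigma> i] s \<sigma> m that by simp
  have less: "coface F s \<sigma> i = s (face i \<sigma>)" if "i < m" for i
  proof -
    have "face i \<sigma> \<in> nerve n P" using face_nerve[OF \<sigma>(1), of i] \<sigma>(2) m that by simp
    from cochain_value[OF s this] show ?thesis
      unfolding coface_def using last_face_less[of i \<sigma>] m that \<sigma>(1) by (simp add: res_id last_nerve)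
  qed
  have closed': "s (face i \<sigma>) [^]\<^bsub>obj F (last \<sigma>)\<^esub> ((- 1) ^ i :: int) \<in> carrier (obj F (last \<sigma>))"
    if "i < m" for i
    using closed[of i] less[OF that] that by simp
  have "(\<Otimes>\<^bsub>obj F (last \<sigma>)\<^esub>i\<in>{..<length \<sigma>}. coface F s \<sigma> i [^]\<^bsub>obj F (last \<sigma>)\<^esub> ((- 1) ^ i :: int))
      = coface F s \<sigma> m [^]\<^bsub>obj F (last \<sigma>)\<^esub> ((- 1) ^ m :: int) \<otimes>\<^bsub>obj F (last \<sigma>)\<^esub>
        (\<Otimes>\<^bsub>obj F (last \<sigma>)\<^esub>i\<in>{..<m}. coface F s \<sigma> i [^]\<^bsub>obj F (last \<sigma>)\<^esub> ((- 1) ^ i :: int))"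
    unfolding m(2) lessThan_Suc by (rule G.finprod_insert) (auto simp: closed)
  also have "(\<Otimes>\<^bsub>obj F (last \<sigma>)\<^esub>i\<in>{..<m}. coface F s \<sigma> i [^]\<^bsub>obj F (last \<sigma>)\<^esub> ((- 1) ^ i :: int))
      = (\<Otimes>\<^bsub>obj F (last \<sigma>)\<^esub>i\<in>{..<m}. s (face i \<sigma>) [^]\<^bsub>obj F (last \<sigma>)\<^esub> ((- 1) ^ i :: int))"
    (is "?A = ?B")
    by (rule G.finprod_cong') (use closed' less in auto)
  also have "coface F s \<sigma> m = res F (\<sigma> ! (m - 1)) (last \<sigma>) (s (face m \<sigma>))"
    using last_face_last[OF \<sigma>(2)] m by (simp add: coface_def)
  finally have eq: "(\<Otimes>\<^bsub>obj F (last \<sigma>)\<^esub>i\<in>{..<length \<sigma>}. coface F s \<sigma> i [^]\<^bsub>obj F (last \<sigma>)\<^esub> ((- 1) ^ i :: int))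
      = res F (\<sigma> ! (m - 1)) (last \<sigma>) (s (face m \<sigma>)) [^]\<^bsub>obj F (last \<sigma>)\<^esub> ((- 1) ^ m :: int) \<otimes>\<^bsub>obj F (last \<sigma>)\<^esub> ?B" .
  have "?B \<in> carrier (obj F (last \<sigma>))"
    using closed' by (intro G.finprod_closed) auto
  moreover have "res F (\<sigma> ! (m - 1)) (last \<sigma>) (s (face m \<sigma>)) [^]\<^bsub>obj F (last \<sigma>)\<^esub> ((- 1) ^ m :: int)
      \<in> carrier (obj F (last \<sigma>))"
    using closed[of m] last_face_last[OF \<sigma>(2)] m by (simp add: coface_def)
  ultimately show ?thesis
    unfolding eq using \<sigma>(1) m last by (simp add: cochain_differential_def Let_def G.m_comm)
qed

lemma differential_closed:
  assumes s: "s \<in> carrier (grp (cochains P F) n)"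
  shows "cochain_differential P F n s \<in> carrier (grp (cochains P F) (n + 1))"
proof -
  have "cochain_differential P F n s \<sigma> \<in> carrier (obj F (last \<sigma>))" if \<sigma>: "\<sigma> \<in> nerve (n + 1) P" for \<sigma>
  proof (cases "2 \<le> length \<sigma>")
    case True
    interpret G: comm_group "obj F (last \<sigma>)" using \<sigma> by (blast intro: obj_comm_group last_nerve)
    show ?thesis
      using True s \<sigma> coface_closed[of s "n + 1" \<sigma>] unfolding differential_eq[OF s \<sigma> True]
      by (intro G.finprod_closed) auto
  next
    case False
    with \<sigma> have "length \<sigma> = 1" by (rule nerve_length_1)
    then show ?thesis
      using \<sigma> obj_group[OF last_nerve[OF \<sigma>]] by (simp add: differential_length_1 group.is_monoid monoid.one_closed)
  qed
  then show ?thesis by (auto simp: cochains_def cochain_differential_def)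
qed

lemma cochains_mult:
  "\<sigma> \<in> nerve n P \<Longrightarrow> (s \<otimes>\<^bsub>grp (cochains P F) n\<^esub> t) \<sigma> = s \<sigma> \<otimes>\<^bsub>obj F (last \<sigma>)\<^esub> t \<sigma>"
  by (simp add: cochains_def)

lemma cochains_one: "\<sigma> \<in> nerve n P \<Longrightarrow> \<one>\<^bsub>grp (cochains P F) n\<^esub> \<sigma> = \<one>\<^bsub>obj F (last \<sigma>)\<^esub>"
  by (simp add: cochains_def)

lemma cochains_ext:
  assumes "s \<in> carrier (grp (cochains P F) n)" "t \<in> carrier (grp (cochains P F) n)"
    and "\<And>\<sigma>. \<sigma> \<in> nerve n P \<Longrightarrow> s \<sigma> = t \<sigma>"
  shows "s = t"
  using assms by (auto simp: cochains_def intro: PiE_ext)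

lemma comm_group_cochains: "comm_group (grp (cochains P F) n)"
proof (rule group.group_comm_groupI)
  show "group (grp (cochains P F) n)"
    by (simp add: cochains_def obj_group last_nerve)
  show "x \<otimes>\<^bsub>grp (cochains P F) n\<^esub> y = y \<otimes>\<^bsub>grp (cochains P F) n\<^esub> x"
    if "x \<in> carrier (grp (cochains P F) n)" "y \<in> carrier (grp (cochains P F) n)" for x y
    using that obj_comm_group[OF last_nerve]
    by (auto simp: cochains_def PiE_iff comm_group_def intro!: restrict_ext comm_monoid.m_comm)
qed

lemma cochains_inv:
  "s \<in> carrier (grp (cochains P F) n) \<Longrightarrow> \<sigma> \<in> nerve n P \<Longrightarrow>
     (inv\<^bsub>grp (cochains P F) n\<^esub> s) \<sigma> = inv\<^bsub>obj F (last \<sigma>)\<^esub> s \<sigma>"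
  by (simp add: cochains_def obj_group last_nerve)

lemma coface_mult:
  assumes "s \<in> carrier (grp (cochains P F) (n - 1))" "t \<in> carrier (grp (cochains P F) (n - 1))"
    and "\<sigma> \<in> nerve n P" "i < length \<sigma>" "2 \<le> length \<sigma>"
  shows "coface F (s \<otimes>\<^bsub>grp (cochains P F) (n - 1)\<^esub> t) \<sigma> i =
    coface F s \<sigma> i \<otimes>\<^bsub>obj F (last \<sigma>)\<^esub> coface F t \<sigma> i"
  unfolding coface_def cochains_mult[OF face_nerve[OF assms(3-5)]]
  by (rule hom_mult[OF res_hom[OF last_nerve[OF assms(3)] last_nerve[OF face_nerve[OF assms(3-5)]]
        last_le_last_face[OF assms(3-5)]]])
    (rule cochain_value[OF assms(1) face_nerve[OF assms(3-5)]] cochain_value[OF assms(2) face_nerve[OF assms(3-5)]])+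

lemma differential_hom:
  "cochain_differential P F n \<in> hom (grp (cochains P F) n) (grp (cochains P F) (n + 1))"
proof (rule homI)
  fix s t assume st: "s \<in> carrier (grp (cochains P F) n)" "t \<in> carrier (grp (cochains P F) n)"
  interpret C: comm_group "grp (cochains P F) k" for k by (rule comm_group_cochains)
  show "cochain_differential P F n (s \<otimes>\<^bsub>grp (cochains P F) n\<^esub> t) =
      cochain_differential P F n s \<otimes>\<^bsub>grp (cochains P F) (n + 1)\<^esub> cochain_differential P F n t"
  proof (rule cochains_ext)
    fix \<sigma> assume \<sigma>: "\<sigma> \<in> nerve (n + 1) P"
    interpret G: comm_group "obj F (last \<sigma>)" using \<sigma> by (blast intro: obj_comm_group last_nerve)
    show "cochain_differential P F n (s \<otimes>\<^bsub>grp (cochains P F) n\<^esub> t) \<sigma> =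
      (cochain_differential P F n s \<otimes>\<^bsub>grp (cochains P F) (n + 1)\<^esub> cochain_differential P F n t) \<sigma>"
    proof (cases "2 \<le> length \<sigma>")
      case True
      note closed = coface_closed[of s "n + 1" \<sigma>] coface_closed[of t "n + 1" \<sigma>]
      show ?thesis
        unfolding cochains_mult[OF \<sigma>] differential_eq[OF st(1) \<sigma> True]
          differential_eq[OF st(2) \<sigma> True] differential_eq[OF C.m_closed[OF st] \<sigma> True]
        using st \<sigma> True closed coface_mult[of s "n + 1" t \<sigma>]
        by (intro trans[OF G.finprod_cong' G.finprod_multf]) (auto simp: G.int_pow_distrib)
    next
      case False
      with \<sigma> have "length \<sigma> = 1" by (rule nerve_length_1)
      then show ?thesis using \<sigma> by (simp add: cochains_mult differential_length_1)
    qed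
  qed (use st in \<open>simp_all add: differential_closed\<close>)
qed (rule differential_closed)

text \<open>
  For simplices with at least three vertices this is the cancellation of the codimension two faces;
  their contributions depend only on the face by functoriality of restriction. The two shorter cases come
  from the zero differential out of degree \<open>-1\<close>.
\<close>

lemma differential_differential:
  assumes s: "s \<in> carrier (grp (cochains P F) (n - 1))"
  shows "cochain_differential P F n (cochain_differential P F (n - 1) s) = \<one>\<^bsub>grp (cochains P F) (n + 1)\<^esub>"
proof (rule cochains_ext)
  interpret C: comm_group "grp (cochains P F) k" for k by (rule comm_group_cochains)
  let ?ds = "cochain_differential P F (n - 1) s"
  have ds: "?ds \<in> carrier (grp (cochains P F) n)" using differential_closed[OF s] by simp
  then show "cochain_differential P F n ?ds \<in> carrier (grp (cochains P F) (n + 1))"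
    by (rule differential_closed)
  fix \<sigma> assume \<sigma>: "\<sigma> \<in> nerve (n + 1) P"
  let ?G = "obj F (last \<sigma>)"
  interpret G: comm_group ?G using \<sigma> by (blast intro: obj_comm_group last_nerve)
  have hom: "group_hom (obj F (last (face i \<sigma>))) ?G (res F (last (face i \<sigma>)) (last \<sigma>))"
    if "i < length \<sigma>" "2 \<le> length \<sigma>" for i
    using that \<sigma> by (blast intro: res_group_hom last_nerve face_nerve last_le_last_face)
  have "cochain_differential P F n ?ds \<sigma> = \<one>\<^bsub>?G\<^esub>"
  proof (cases "3 \<le> length \<sigma>")
    case True
    define m where "m = length \<sigma> - 1"
    have m: "length \<sigma> = Suc m" "2 \<le> m" using True by (auto simp: m_def)
    have \<sigma>2: "2 \<le> length \<sigma>" using True by simp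
    have f: "face i \<sigma> \<in> nerve n P" "length (face i \<sigma>) = m" "last \<sigma> \<le> last (face i \<sigma>)" if "i \<le> m" for i
      using face_nerve[OF \<sigma>] last_le_last_face[OF \<sigma>] m that by (auto simp: length_face)
    have ff: "face j (face i \<sigma>) \<in> nerve (n - 1) P" "last (face i \<sigma>) \<le> last (face j (face i \<sigma>))"
      if "i \<le> m" "j < m" for i j
      using face_nerve[OF f(1)] last_le_last_face[OF f(1)] f(2) m that by auto
    let ?h = "\<lambda>i j. res F (last (face j (face i \<sigma>))) (last \<sigma>) (s (face j (face i \<sigma>)))"
    have h: "?h i j \<in> carrier ?G" if "i \<le> m" "j < m" for i j
      using ff[OF that] f[OF that(1)] \<sigma> s by (meson res_closed last_nerve cochain_value order_trans)
    have "coface F ?ds \<sigma> i [^]\<^bsub>?G\<^esub> ((- 1) ^ i :: int) =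
        (\<Otimes>\<^bsub>?G\<^esub>j\<in>{..<m}. ?h i j [^]\<^bsub>?G\<^esub> ((- 1) ^ (i + j) :: int))" if i: "i \<le> m" for i
    proof -
      let ?H = "obj F (last (face i \<sigma>))"
      interpret H: comm_group ?H using f[OF i] by (blast intro: obj_comm_group last_nerve)
      interpret r: group_hom ?H ?G "res F (last (face i \<sigma>)) (last \<sigma>)"
        using hom i m by simp
      have cl: "coface F s (face i \<sigma>) j \<in> carrier ?H" if "j < m" for j
        using coface_closed[OF s f(1)] f(2) i m that by simp
      have "?ds (face i \<sigma>) = (\<Otimes>\<^bsub>?H\<^esub>j\<in>{..<m}. coface F s (face i \<sigma>) j [^]\<^bsub>?H\<^esub> ((- 1) ^ j :: int))"
        using differential_eq[OF s, of "face i \<sigma>"] f[OF i] m by simp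
      then have "coface F ?ds \<sigma> i = (\<Otimes>\<^bsub>?G\<^esub>j\<in>{..<m}.
          res F (last (face i \<sigma>)) (last \<sigma>) (coface F s (face i \<sigma>) j [^]\<^bsub>?H\<^esub> ((- 1) ^ j :: int)))"
        unfolding coface_def[of F ?ds] using cl
        by (simp only:) (rule r.hom_finprod, simp_all add: H.comm_group_axioms G.comm_group_axioms)
      also have "\<dots> = (\<Otimes>\<^bsub>?G\<^esub>j\<in>{..<m}. ?h i j [^]\<^bsub>?G\<^esub> ((- 1) ^ j :: int))"
      proof (rule G.finprod_cong')
        fix j assume "j \<in> {..<m}"
        then have j: "j < m" by simp
        have "res F (last (face i \<sigma>)) (last \<sigma>) (coface F s (face i \<sigma>) j) = ?h i j"
          unfolding coface_def
          by (rule res_res) (use i j f(1,3)[OF i] ff[OF i j] \<sigma> s in \<open>blast intro: last_nerve cochain_value\<close>)+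
        then show "res F (last (face i \<sigma>)) (last \<sigma>) (coface F s (face i \<sigma>) j [^]\<^bsub>?H\<^esub> ((- 1) ^ j :: int))
            = ?h i j [^]\<^bsub>?G\<^esub> ((- 1) ^ j :: int)"
          using cl[OF j] by (simp add: r.hom_int_pow)
      qed (use h i in auto)
      finally have "coface F ?ds \<sigma> i [^]\<^bsub>?G\<^esub> ((- 1) ^ i :: int)
          = (\<Otimes>\<^bsub>?G\<^esub>j\<in>{..<m}. (?h i j [^]\<^bsub>?G\<^esub> ((- 1) ^ j :: int)) [^]\<^bsub>?G\<^esub> ((- 1) ^ i :: int))"
        using h i by (simp add: G.finprod_int_pow Pi_iff)
      also have "\<dots> = (\<Otimes>\<^bsub>?G\<^esub>j\<in>{..<m}. ?h i j [^]\<^bsub>?G\<^esub> ((- 1) ^ (i + j) :: int))"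
        using h i by (intro G.finprod_cong') (auto simp: G.int_pow_pow power_add mult.commute)
      finally show ?thesis .
    qed
    then have "cochain_differential P F n ?ds \<sigma> =
        (\<Otimes>\<^bsub>?G\<^esub>i\<in>{..<Suc m}. \<Otimes>\<^bsub>?G\<^esub>j\<in>{..<m}. ?h i j [^]\<^bsub>?G\<^esub> ((- 1) ^ (i + j) :: int))"
      unfolding differential_eq[OF ds \<sigma> \<sigma>2] m(1)
      using h by (intro G.finprod_cong') (auto intro!: G.finprod_closed)
    also have "\<dots> = \<one>\<^bsub>?G\<^esub>"
    proof (rule G.finprod_alternating_square)
      show "?h i j = ?h j (i - 1)" if "j < i" "i \<le> m" for i j
        using face_face[of j i \<sigma>] that m by simp
    qed (rule h)
    finally show ?thesis .
  next
    case False
    show ?thesis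
    proof (cases "2 \<le> length \<sigma>")
      case True
      have "coface F ?ds \<sigma> i = \<one>\<^bsub>?G\<^esub>" if i: "i < length \<sigma>" for i
      proof -
        have "face i \<sigma> \<in> nerve (n - 1 + 1) P" "length (face i \<sigma>) = 1"
          using face_nerve[OF \<sigma> i True] False True i by (auto simp: length_face)
        then show ?thesis
          unfolding coface_def using group_hom.hom_one[OF hom[OF i True]] by (simp only: differential_length_1)
      qed
      then show ?thesis
        unfolding differential_eq[OF ds \<sigma> True] by (intro G.finprod_one_eqI) simp
    next
      case False
      with \<sigma> have "length \<sigma> = 1" by (rule nerve_length_1)
      then show ?thesis using \<sigma> by (simp add: differential_length_1)
    qed
  qed
  then show "cochain_differential P F n ?ds \<sigma> = \<one>\<^bsub>grp (cochains P F) (n + 1)\<^esub> \<sigma>"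
    using \<sigma> by (simp add: cochains_one)
qed (simp add: monoid.one_closed[OF comm_monoid.axioms(1)[OF comm_group.axioms(1)[OF comm_group_cochains]]])

lemma complex_cochains: "complex (cochains P F)"
proof (rule complex.intro)
  show "dif (cochains P F) n \<in> hom (grp (cochains P F) n) (grp (cochains P F) (n + 1))" for n
    using differential_hom by (simp add: cochains_def)
  show "dif (cochains P F) n (dif (cochains P F) (n - 1) x) = \<one>\<^bsub>grp (cochains P F) (n + 1)\<^esub>"
    if "x \<in> carrier (grp (cochains P F) (n - 1))" for x n
    using differential_differential[OF that] by (simp add: cochains_def)
qed (rule comm_group_cochains)

end

section \<open>Restriction and relative cochains\<close>

context poset_presheaf
begin

lemma cochain_restrict_apply: "\<sigma> \<in> nerve n Q \<Longrightarrow> cochain_restrict Q n s \<sigma> = s \<sigma>"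
  by (simp add: cochain_restrict_def)

lemma cochain_restrict_closed:
  "Q \<subseteq> P \<Longrightarrow> s \<in> carrier (grp (cochains P F) n) \<Longrightarrow> cochain_restrict Q n s \<in> carrier (grp (cochains Q F) n)"
  using nerve_mono[of Q P n] by (auto simp: cochains_def cochain_restrict_def)

lemma cochain_map_restrict:
  assumes "Q \<subseteq> P"
  shows "cochain_map (cochains P F) (cochains Q F) (cochain_restrict Q)"
proof -
  interpret Q: poset_presheaf Q F by (rule poset_presheaf_subset[OF assms])
  interpret CP: complex "cochains P F" by (rule complex_cochains)
  interpret CQ: complex "cochains Q F" by (rule Q.complex_cochains)
  show ?thesis
  proof
    show "cochain_restrict Q n \<in> hom (grp (cochains P F) n) (grp (cochains Q F) n)" for n
    proof (rule homI)
      fix s t assume st: "s \<in> carrier (grp (cochains P F) n)" "t \<in> carrier (grp (cochains P F) n)"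
      show "cochain_restrict Q n (s \<otimes>\<^bsub>grp (cochains P F) n\<^esub> t) =
          cochain_restrict Q n s \<otimes>\<^bsub>grp (cochains Q F) n\<^esub> cochain_restrict Q n t"
      proof (rule Q.cochains_ext)
        fix \<sigma> assume "\<sigma> \<in> nerve n Q"
        moreover from this have "\<sigma> \<in> nerve n P" using nerve_mono[OF assms] by blast
        ultimately show "cochain_restrict Q n (s \<otimes>\<^bsub>grp (cochains P F) n\<^esub> t) \<sigma> =
          (cochain_restrict Q n s \<otimes>\<^bsub>grp (cochains Q F) n\<^esub> cochain_restrict Q n t) \<sigma>"
          by (simp add: cochain_restrict_apply Q.cochains_mult cochains_mult)
      qed (use st assms in \<open>simp_all add: cochain_restrict_closed\<close>)
    qed (rule cochain_restrict_closed[OF assms])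
    fix s n assume s: "s \<in> carrier (grp (cochains P F) n)"
    note rs = cochain_restrict_closed[OF assms s]
    show "cochain_restrict Q (n + 1) (dif (cochains P F) n s) = dif (cochains Q F) n (cochain_restrict Q n s)"
    proof (rule Q.cochains_ext)
      fix \<sigma> assume \<sigma>: "\<sigma> \<in> nerve (n + 1) Q"
      then have \<sigma>P: "\<sigma> \<in> nerve (n + 1) P" using nerve_mono[OF assms] by blast
      have "cochain_differential P F n s \<sigma> = cochain_differential Q F n (cochain_restrict Q n s) \<sigma>"
      proof (cases "2 \<le> length \<sigma>")
        case True
        interpret G: comm_group "obj F (last \<sigma>)" using \<sigma>P by (blast intro: obj_comm_group last_nerve)
        have "coface F (cochain_restrict Q n s) \<sigma> i = coface F s \<sigma> i" if "i < length \<sigma>" for i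
          using face_nerve[OF \<sigma> that True] by (simp add: coface_def cochain_restrict_apply)
        then show ?thesis
          unfolding differential_eq[OF s \<sigma>P True] Q.differential_eq[OF rs \<sigma> True]
          using coface_closed[of s "n + 1" \<sigma>] s \<sigma>P True
          by (intro G.finprod_cong') auto
      next
        case False
        with \<sigma> have "length \<sigma> = 1" by (rule nerve_length_1)
        then show ?thesis using \<sigma> \<sigma>P by (simp add: differential_length_1 Q.differential_length_1)
      qed
      then show "cochain_restrict Q (n + 1) (dif (cochains P F) n s) \<sigma> =
          dif (cochains Q F) n (cochain_restrict Q n s) \<sigma>"
        using \<sigma> by (simp add: cochain_restrict_apply cochains_def)
    qed (use s rs assms in \<open>simp_all add: cochain_restrict_closed\<close>)
  qed
qed

lemma carrier_rel_cochains:
  "carrier (grp (rel_cochains P Q F) n) =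
     {s \<in> carrier (grp (cochains P F) n). \<forall>\<sigma> \<in> nerve n Q. s \<sigma> = \<one>\<^bsub>obj F (last \<sigma>)\<^esub>}"
  by (auto simp: rel_cochains_def kernel_def cochains_def cochain_restrict_def restrict_def fun_eq_iff)

lemma subgroup_rel_cochains:
  assumes "Q \<subseteq> P"
  shows "subgroup (carrier (grp (rel_cochains P Q F) n)) (grp (cochains P F) n)"
proof -
  interpret r: cochain_map "cochains P F" "cochains Q F" "cochain_restrict Q"
    by (rule cochain_map_restrict[OF assms])
  show ?thesis using r.map.subgroup_kernel by (simp add: rel_cochains_def)
qed

lemma dif_rel_cochains:
  assumes "Q \<subseteq> P" "s \<in> carrier (grp (rel_cochains P Q F) n)"
  shows "dif (cochains P F) n s \<in> carrier (grp (rel_cochains P Q F) (n + 1))"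
proof -
  interpret r: cochain_map "cochains P F" "cochains Q F" "cochain_restrict Q"
    by (rule cochain_map_restrict[OF assms(1)])
  show ?thesis using assms(2) by (simp add: rel_cochains_def kernel_def r.map_dif)
qed

lemma complex_rel_cochains:
  assumes "Q \<subseteq> P"
  shows "complex (rel_cochains P Q F)"
proof -
  interpret C: complex "cochains P F" by (rule complex_cochains)
  have "rel_cochains P Q F = \<lparr>grp = (\<lambda>n. (grp (cochains P F) n)
      \<lparr>carrier := carrier (grp (rel_cochains P Q F) n)\<rparr>), dif = dif (cochains P F)\<rparr>"
    by (simp add: rel_cochains_def)
  with C.complex_subcomplex[OF subgroup_rel_cochains[OF assms] dif_rel_cochains[OF assms]]
  show ?thesis by simp
qed

lemma rel_cochains_simps [simp]:
  "monoid.mult (grp (rel_cochains P Q F) n) = monoid.mult (grp (cochains P F) n)"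
  "one (grp (rel_cochains P Q F) n) = one (grp (cochains P F) n)"
  "dif (rel_cochains P Q F) = dif (cochains P F)"
  by (simp_all add: rel_cochains_def)

lemma rel_cochains_carrier: "s \<in> carrier (grp (rel_cochains P Q F) n) \<Longrightarrow> s \<in> carrier (grp (cochains P F) n)"
  by (simp add: carrier_rel_cochains)

lemma rel_cochains_mono: "Q \<subseteq> R \<Longrightarrow> carrier (grp (rel_cochains P R F) n) \<subseteq> carrier (grp (rel_cochains P Q F) n)"
  using nerve_mono[of Q R n] by (auto simp: carrier_rel_cochains)

lemma div_mem_rel_cochains_iff:
  assumes "Q \<subseteq> P" "s \<in> carrier (grp (cochains P F) n)" "t \<in> carrier (grp (cochains P F) n)"
  shows "s \<otimes>\<^bsub>grp (cochains P F) n\<^esub> inv\<^bsub>grp (cochains P F) n\<^esub> t \<in> carrier (grp (rel_cochains P Q F) n)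
    \<longleftrightarrow> (\<forall>\<sigma> \<in> nerve n Q. s \<sigma> = t \<sigma>)"
proof -
  interpret C: complex "cochains P F" by (rule complex_cochains)
  have "(s \<otimes>\<^bsub>grp (cochains P F) n\<^esub> inv\<^bsub>grp (cochains P F) n\<^esub> t) \<sigma> = \<one>\<^bsub>obj F (last \<sigma>)\<^esub>
      \<longleftrightarrow> s \<sigma> = t \<sigma>" if "\<sigma> \<in> nerve n Q" for \<sigma>
  proof -
    have \<sigma>: "\<sigma> \<in> nerve n P" using that nerve_mono[OF assms(1)] by blast
    interpret G: comm_group "obj F (last \<sigma>)" using \<sigma> by (blast intro: obj_comm_group last_nerve)
    show ?thesis
      using cochain_value[OF assms(2) \<sigma>] cochain_value[OF assms(3) \<sigma>] assms(3) \<sigma> 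
        G.inv_solve_right'[of "\<one>\<^bsub>obj F (last \<sigma>)\<^esub>" "s \<sigma>" "t \<sigma>"]
      by (simp add: cochains_mult cochains_inv)
  qed
  then show ?thesis using assms by (simp add: carrier_rel_cochains)
qed

lemma cochain_restrict_eq_iff:
  "cochain_restrict Q n s = cochain_restrict Q n t \<longleftrightarrow> (\<forall>\<sigma> \<in> nerve n Q. s \<sigma> = t \<sigma>)"
  unfolding cochain_restrict_def by (metis restrict_apply' restrict_ext)

lemma cochain_restrict_rel:
  assumes "R \<subseteq> Q" "Q \<subseteq> P" "s \<in> carrier (grp (rel_cochains P R F) n)"
  shows "cochain_restrict Q n s \<in> carrier (grp (rel_cochains Q R F) n)"
proof -
  interpret Q: poset_presheaf Q F by (rule poset_presheaf_subset[OF assms(2)])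
  show ?thesis
    using assms subsetD[OF nerve_mono[OF assms(1)]]
    by (simp add: carrier_rel_cochains Q.carrier_rel_cochains cochain_restrict_closed cochain_restrict_apply)
qed

text \<open>
  Cochains extend by the identity element.
\<close>

lemma cochain_restrict_surj:
  assumes "R \<subseteq> Q" "Q \<subseteq> P" "t \<in> carrier (grp (rel_cochains Q R F) n)"
  shows "\<exists>s \<in> carrier (grp (rel_cochains P R F) n). cochain_restrict Q n s = t"
proof -
  interpret Q: poset_presheaf Q F by (rule poset_presheaf_subset[OF assms(2)])
  let ?s = "\<lambda>\<sigma> \<in> nerve n P. if \<sigma> \<in> nerve n Q then t \<sigma> else \<one>\<^bsub>obj F (last \<sigma>)\<^esub>"
  have t: "t \<in> carrier (grp (cochains Q F) n)" "\<forall>\<sigma> \<in> nerve n R. t \<sigma> = \<one>\<^bsub>obj F (last \<sigma>)\<^esub>"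
    using assms(3) by (auto simp: Q.carrier_rel_cochains)
  have "?s \<in> carrier (grp (cochains P F) n)"
    using Q.cochain_value[OF t(1)] obj_group[OF last_nerve]
    by (auto simp: cochains_def group.is_monoid monoid.one_closed)
  moreover have "?s \<sigma> = \<one>\<^bsub>obj F (last \<sigma>)\<^esub>" if "\<sigma> \<in> nerve n R" for \<sigma>
    using that t(2) nerve_mono[of R P n] assms(1,2) by auto
  moreover have "cochain_restrict Q n ?s = t"
    using t(1) nerve_mono[OF assms(2), of n]
    by (auto simp: cochain_restrict_def cochains_def fun_eq_iff restrict_def PiE_iff extensional_def)
  ultimately show ?thesis
    by (intro bexI[of _ ?s]) (auto simp: carrier_rel_cochains)
qed

lemma short_exact_sequence_rel:
  assumes "R \<subseteq> Q" "Q \<subseteq> P"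
  shows "short_exact_sequence (rel_cochains P Q F) (rel_cochains P R F) (rel_cochains Q R F)
    (\<lambda>n s. s) (cochain_restrict Q)"
proof -
  interpret Q: poset_presheaf Q F by (rule poset_presheaf_subset[OF assms(2)])
  interpret A: complex "rel_cochains P Q F" by (rule complex_rel_cochains[OF assms(2)])
  interpret B: complex "rel_cochains P R F" using assms by (intro complex_rel_cochains) blast
  interpret D: complex "rel_cochains Q R F" by (rule Q.complex_rel_cochains[OF assms(1)])
  interpret r: cochain_map "cochains P F" "cochains Q F" "cochain_restrict Q"
    by (rule cochain_map_restrict[OF assms(2)])
  note sub = subsetD[OF rel_cochains_mono[OF assms(1)]]
  show ?thesis
  proof
    show "(\<lambda>s. s) \<in> hom (grp (rel_cochains P Q F) n) (grp (rel_cochains P R F) n)" for n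
      by (rule homI) (simp_all add: sub)
    show "dif (rel_cochains P Q F) n x = dif (rel_cochains P R F) n x" for n x by simp
    show "cochain_restrict Q n \<in> hom (grp (rel_cochains P R F) n) (grp (rel_cochains Q R F) n)" for n
      by (rule homI) (simp_all add: cochain_restrict_rel[OF assms] rel_cochains_carrier)
    show "cochain_restrict Q (n + 1) (dif (rel_cochains P R F) n x) =
        dif (rel_cochains Q R F) n (cochain_restrict Q n x)"
      if "x \<in> carrier (grp (rel_cochains P R F) n)" for n x
      using that by (simp add: r.map_dif rel_cochains_carrier)
    show "inj_on (\<lambda>s. s) (carrier (grp (rel_cochains P Q F) n))" for n by simp
    show "cochain_restrict Q n ` carrier (grp (rel_cochains P R F) n) = carrier (grp (rel_cochains Q R F) n)" for n
      using cochain_restrict_rel[OF assms, of _ n] cochain_restrict_surj[OF assms, of _ n] by blast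
    show "(\<lambda>s. s) ` carrier (grp (rel_cochains P Q F) n) =
        kernel (grp (rel_cochains P R F) n) (grp (rel_cochains Q R F) n) (cochain_restrict Q n)" for n
      using sub by (auto simp: kernel_def rel_cochains_def)
  qed
qed

lemma restricted_cocycle:
  assumes "R \<subseteq> Q" "Q \<subseteq> P" "s \<in> carrier (grp (rel_cochains P R F) i)"
    and "dif (cochains P F) i s \<in> carrier (grp (rel_cochains P Q F) (i + 1))"
  shows "cochain_restrict Q i s \<in> cocycles (rel_cochains Q R F) i"
proof -
  interpret Q: poset_presheaf Q F by (rule poset_presheaf_subset[OF assms(2)])
  interpret D: complex "rel_cochains Q R F" by (rule Q.complex_rel_cochains[OF assms(1)])
  interpret r: cochain_map "cochains P F" "cochains Q F" "cochain_restrict Q"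
    by (rule cochain_map_restrict[OF assms(2)])
  have "cochain_restrict Q (i + 1) (dif (cochains P F) i s) = \<one>\<^bsub>grp (cochains Q F) (i + 1)\<^esub>"
    using assms(4) by (simp add: rel_cochains_def kernel_def)
  then show ?thesis
    using assms by (simp add: D.cocycles_iff cochain_restrict_rel r.map_dif rel_cochains_carrier)
qed

text \<open>
  Vanishing of a relative class of the pair \<open>(Q, R)\<close>, expressed by cochains on all of \<open>P\<close>. A cobounding
  cochain on \<open>Q\<close> is extended to \<open>P\<close>; the remaining difference vanishes on \<open>Q\<close>.
\<close>

lemma restricted_class_eq_one_iff:
  assumes "R \<subseteq> Q" "Q \<subseteq> P" "s \<in> carrier (grp (rel_cochains P R F) i)"
    and "dif (cochains P F) i s \<in> carrier (grp (rel_cochains P Q F) (i + 1))"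
  shows "cohomology_class (rel_cochains Q R F) i (cochain_restrict Q i s) = \<one>\<^bsub>HS_rel Q R F i\<^esub> \<longleftrightarrow>
    (\<exists>t \<in> carrier (grp (rel_cochains P R F) (i - 1)).
      s \<otimes>\<^bsub>grp (cochains P F) i\<^esub> inv\<^bsub>grp (cochains P F) i\<^esub> dif (cochains P F) (i - 1) t
        \<in> carrier (grp (rel_cochains P Q F) i))"
proof -
  interpret Q: poset_presheaf Q F by (rule poset_presheaf_subset[OF assms(2)])
  interpret D: complex "rel_cochains Q R F" by (rule Q.complex_rel_cochains[OF assms(1)])
  interpret C: complex "cochains P F" by (rule complex_cochains)
  interpret e: short_exact_sequence "rel_cochains P Q F" "rel_cochains P R F" "rel_cochains Q R F"
    "\<lambda>n s. s" "cochain_restrict Q"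
    by (rule short_exact_sequence_rel[OF assms(1,2)])
  have s: "s \<in> carrier (grp (cochains P F) i)" using assms(3) by (rule rel_cochains_carrier)
  have eq: "cochain_restrict Q i s = dif (cochains Q F) (i - 1) (cochain_restrict Q (i - 1) t) \<longleftrightarrow>
      s \<otimes>\<^bsub>grp (cochains P F) i\<^esub> inv\<^bsub>grp (cochains P F) i\<^esub> dif (cochains P F) (i - 1) t
        \<in> carrier (grp (rel_cochains P Q F) i)"
    if "t \<in> carrier (grp (rel_cochains P R F) (i - 1))" for t
    using e.p.map_dif_pred[OF that] C.dif_closed_pred[OF rel_cochains_carrier[OF that]] s assms(2)
    by (simp add: div_mem_rel_cochains_iff cochain_restrict_eq_iff flip: cochain_restrict_eq_iff)
  have "cohomology_class (rel_cochains Q R F) i (cochain_restrict Q i s) = \<one>\<^bsub>HS_rel Q R F i\<^esub> \<longleftrightarrow>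
      cochain_restrict Q i s \<in> dif (cochains Q F) (i - 1) ` carrier (grp (rel_cochains Q R F) (i - 1))"
    unfolding HS_rel_def D.cohomology_class_eq_one_iff[OF restricted_cocycle[OF assms]]
    by (simp add: coboundaries_def)
  also have "\<dots> \<longleftrightarrow> (\<exists>t \<in> carrier (grp (rel_cochains P R F) (i - 1)).
      cochain_restrict Q i s = dif (cochains Q F) (i - 1) (cochain_restrict Q (i - 1) t))"
    unfolding e.surj[symmetric] by blast
  also have "\<dots> \<longleftrightarrow> (\<exists>t \<in> carrier (grp (rel_cochains P R F) (i - 1)).
      s \<otimes>\<^bsub>grp (cochains P F) i\<^esub> inv\<^bsub>grp (cochains P F) i\<^esub> dif (cochains P F) (i - 1) t
        \<in> carrier (grp (rel_cochains P Q F) i))"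
    using eq by blast
  finally show ?thesis .
qed

end

section \<open>The filtration by skeleta\<close>

lemma skeleton_subset: "skeleton P rk k \<subseteq> P"
  by (auto simp: skeleton_def)

lemma skeleton_mono: "k \<le> l \<Longrightarrow> skeleton P rk k \<subseteq> skeleton P rk l"
  by (auto simp: skeleton_def)

lemma skeleton_negative:
  assumes "bdd_above (rk ` P)" "k < 0"
  shows "skeleton P rk k = {}"
proof -
  have "0 \<le> corank P rk x" if "x \<in> P" for x
    using cSUP_upper[OF that assms(1)] by (simp add: corank_def)
  then show ?thesis using assms(2) by (fastforce simp: skeleton_def)
qed

text \<open>
  The finitely many vertices of a simplex have bounded corank. This is what makes the filtration by skeleta separated
  and complete.
\<close>

lemma nerve_skeleton_exhausts:
  assumes "\<sigma> \<in> nerve n P"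
  shows "\<exists>j. \<sigma> \<in> nerve n (skeleton P rk (k + int j))"
proof -
  have "bdd_above (corank P rk ` set \<sigma>)" by (intro bdd_above_finite) simp
  then obtain B where B: "\<And>x. x \<in> set \<sigma> \<Longrightarrow> corank P rk x \<le> B"
    by (auto simp: bdd_above_def)
  have "set \<sigma> \<subseteq> skeleton P rk (k + int (nat (B - k)))"
    using B assms by (fastforce simp: skeleton_def nerve_def)
  then show ?thesis using assms by (intro exI[of _ "nat (B - k)"]) (simp add: nerve_def)
qed

text \<open>
  Cellularity quantifies over all presheaves with a fixed type of coefficients; fixing one presheaf \<open>F\<close>
  avoids carrying that type as a parameter.
\<close>

locale cellular_presheaf = poset_presheaf P F
  for P :: "'a::order set" and F :: "('a, 'b) presheaf" +
  fixes rk :: "'a \<Rightarrow> int"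
  assumes bdd: "bdd_above (rk ` P)"
    and acyclic: "i \<noteq> n \<Longrightarrow> trivial_group (HS_rel (skeleton P rk n) (skeleton P rk (n - 1)) F i)"
begin

abbreviation Sk :: "int \<Rightarrow> 'a set" where "Sk \<equiv> skeleton P rk"

definition K :: "int \<Rightarrow> int \<Rightarrow> ('a list \<Rightarrow> 'b) set" where
  "K k n = carrier (grp (rel_cochains P (Sk k) F) n)"

definition cell_class :: "int \<Rightarrow> ('a list \<Rightarrow> 'b) \<Rightarrow> ('a list \<Rightarrow> 'b) set" where
  "cell_class n s = cohomology_class (rel_cochains (Sk n) (Sk (n - 1)) F) n (cochain_restrict (Sk n) n s)"

lemma skeleton_pred: "Sk (n - 1) \<subseteq> Sk n"
  by (rule skeleton_mono) simp

lemma K_div_iff: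
  "s \<in> carrier (grp (cochains P F) n) \<Longrightarrow> t \<in> carrier (grp (cochains P F) n) \<Longrightarrow>
    s \<otimes>\<^bsub>grp (cochains P F) n\<^esub> inv\<^bsub>grp (cochains P F) n\<^esub> t \<in> K k n \<longleftrightarrow> (\<forall>\<sigma> \<in> nerve n (Sk k). s \<sigma> = t \<sigma>)"
  unfolding K_def by (rule div_mem_rel_cochains_iff[OF skeleton_subset])

text \<open>
  On a given simplex the sequence becomes constant as soon as the simplex lies in the skeleton in question; the
  limit takes this value.
\<close>

lemma cochains_complete:
  assumes u: "\<And>j. u j \<in> carrier (grp (cochains P F) n)"
    and step: "\<And>j :: nat. u (Suc j) \<otimes>\<^bsub>grp (cochains P F) n\<^esub> inv\<^bsub>grp (cochains P F) n\<^esub> u j \<in> K (k + int j) n"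
  shows "\<exists>x \<in> carrier (grp (cochains P F) n).
    \<forall>j. x \<otimes>\<^bsub>grp (cochains P F) n\<^esub> inv\<^bsub>grp (cochains P F) n\<^esub> u j \<in> K (k + int j) n"
proof -
  have stable: "u j' \<sigma> = u j \<sigma>" if "j \<le> j'" "\<sigma> \<in> nerve n (Sk (k + int j))" for j j' \<sigma>
    using that(1)
  proof (induction j' rule: dec_induct)
    case (step i)
    have "\<sigma> \<in> nerve n (Sk (k + int i))"
      using that(2) nerve_mono[OF skeleton_mono[of "k + int j" "k + int i"]] step.hyps by auto
    then show ?case using assms(2)[of i] step.IH by (simp add: K_div_iff u)
  qed simp
  have agree: "u j' \<sigma> = u j \<sigma>"
    if "\<sigma> \<in> nerve n (Sk (k + int j))" "\<sigma> \<in> nerve n (Sk (k + int j'))" for j j' \<sigma>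
    using stable[of j j'] stable[of j' j] that by (cases "j \<le> j'") auto
  let ?j = "\<lambda>\<sigma>. SOME j. \<sigma> \<in> nerve n (Sk (k + int j))"
  let ?x = "\<lambda>\<sigma> \<in> nerve n P. u (?j \<sigma>) \<sigma>"
  have x: "?x \<in> carrier (grp (cochains P F) n)"
    using cochain_value[OF u] by (auto simp: cochains_def)
  moreover have "?x \<otimes>\<^bsub>grp (cochains P F) n\<^esub> inv\<^bsub>grp (cochains P F) n\<^esub> u j \<in> K (k + int j) n" for j
    unfolding K_div_iff[OF x u]
  proof
    fix \<sigma> assume \<sigma>: "\<sigma> \<in> nerve n (Sk (k + int j))"
    then have "\<sigma> \<in> nerve n (Sk (k + int (?j \<sigma>)))"
      by (rule someI[of "\<lambda>j. \<sigma> \<in> nerve n (Sk (k + int j))"])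
    then have "u (?j \<sigma>) \<sigma> = u j \<sigma>" using \<sigma> by (intro agree)
    moreover have "\<sigma> \<in> nerve n P" using \<sigma> nerve_mono[OF skeleton_subset] by blast
    ultimately show "?x \<sigma> = u j \<sigma>" by simp
  qed
  ultimately show ?thesis by blast
qed

lemma complete_filtration: "complete_filtration (cochains P F) K"
proof -
  interpret C: complex "cochains P F" by (rule complex_cochains)
  show ?thesis
  proof (rule complete_filtration.intro[OF complex_cochains complete_filtration_axioms.intro])
    show "subgroup (K k n) (grp (cochains P F) n)" for k n
      unfolding K_def by (rule subgroup_rel_cochains[OF skeleton_subset])
    show "K l n \<subseteq> K k n" if "k \<le> l" for k l n
      unfolding K_def by (rule rel_cochains_mono[OF skeleton_mono[OF that]])
    show "dif (cochains P F) n x \<in> K k (n + 1)" if "x \<in> K k n" for x k n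
      using that unfolding K_def by (rule dif_rel_cochains[OF skeleton_subset])
    show "K k n = carrier (grp (cochains P F) n)" if "k < 0" for k n
      using skeleton_negative[OF bdd that] by (auto simp: K_def carrier_rel_cochains nerve_def)
    show "x = \<one>\<^bsub>grp (cochains P F) n\<^esub>"
      if x: "x \<in> carrier (grp (cochains P F) n)" "\<And>k. x \<in> K k n" for x n
    proof (rule cochains_ext)
      fix \<sigma> assume \<sigma>: "\<sigma> \<in> nerve n P"
      then obtain j where "\<sigma> \<in> nerve n (Sk (0 + int j))" using nerve_skeleton_exhausts by blast
      then show "x \<sigma> = \<one>\<^bsub>grp (cochains P F) n\<^esub> \<sigma>"
        using x(2)[of "0 + int j"] \<sigma> unfolding K_def by (simp add: carrier_rel_cochains cochains_one)
    qed (simp_all add: x)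
    show "\<exists>x \<in> carrier (grp (cochains P F) n).
        \<forall>j. x \<otimes>\<^bsub>grp (cochains P F) n\<^esub> inv\<^bsub>grp (cochains P F) n\<^esub> u j \<in> K (k + int j) n"
      if "\<And>j. u j \<in> carrier (grp (cochains P F) n)"
        "\<And>j :: nat. u (Suc j) \<otimes>\<^bsub>grp (cochains P F) n\<^esub> inv\<^bsub>grp (cochains P F) n\<^esub> u j \<in> K (k + int j) n"
      for u n k
      using that by (rule cochains_complete)
    show "\<exists>t \<in> K (k - 1) (i - 1).
        s \<otimes>\<^bsub>grp (cochains P F) i\<^esub> inv\<^bsub>grp (cochains P F) i\<^esub> dif (cochains P F) (i - 1) t \<in> K k i"
      if s: "s \<in> K (k - 1) i" "dif (cochains P F) i s \<in> K k (i + 1)" and "i \<noteq> k" for s k i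
    proof -
      interpret Q: poset_presheaf "Sk k" F by (rule poset_presheaf_subset[OF skeleton_subset])
      interpret D: complex "rel_cochains (Sk k) (Sk (k - 1)) F" by (rule Q.complex_rel_cochains[OF skeleton_pred])
      have "cochain_restrict (Sk k) i s \<in> cocycles (rel_cochains (Sk k) (Sk (k - 1)) F) i"
        using s unfolding K_def by (rule restricted_cocycle[OF skeleton_pred skeleton_subset])
      then have "cohomology_class (rel_cochains (Sk k) (Sk (k - 1)) F) i (cochain_restrict (Sk k) i s)
          \<in> carrier (HS_rel (Sk k) (Sk (k - 1)) F i)"
        by (simp add: HS_rel_def D.carrier_cohomology)
      then have "cohomology_class (rel_cochains (Sk k) (Sk (k - 1)) F) i (cochain_restrict (Sk k) i s)
          = \<one>\<^bsub>HS_rel (Sk k) (Sk (k - 1)) F i\<^esub>"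
        using acyclic[OF \<open>i \<noteq> k\<close>] by (simp add: trivial_group_def)
      then show ?thesis
        using s unfolding K_def by (simp add: restricted_class_eq_one_iff[OF skeleton_pred skeleton_subset])
    qed
  qed
qed

lemma restrict_skeleton_hom:
  "cochain_restrict (Sk m) n \<in> hom (grp (cochains P F) n) (grp (cochains (Sk m) F) n)"
  by (rule cochain_map.map_hom[OF cochain_map_restrict[OF skeleton_subset]])

text \<open>
  The restrictions to the skeleton \<open>n + 1\<close> of \<open>s\<close> and \<open>d s\<close> are admissible choices for the lift and for the
  result in the definition of the connecting homomorphism.
\<close>

lemma cell_class_differential:
  assumes s: "s \<in> K (n - 1) n" "dif (cochains P F) n s \<in> K n (n + 1)"
  shows "cellular_differential P rk F n (cell_class n s) = cell_class (n + 1) (dif (cochains P F) n s)"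
proof -
  have sub: "Sk (n - 1) \<subseteq> Sk n" "Sk n \<subseteq> Sk (n + 1)" "Sk (n - 1) \<subseteq> Sk (n + 1)" by (simp_all add: skeleton_mono)
  interpret Q: poset_presheaf "Sk (n + 1)" F by (rule poset_presheaf_subset[OF skeleton_subset])
  interpret e: short_exact_sequence "rel_cochains (Sk (n + 1)) (Sk n) F"
    "rel_cochains (Sk (n + 1)) (Sk (n - 1)) F" "rel_cochains (Sk n) (Sk (n - 1)) F"
    "\<lambda>m s. s" "cochain_restrict (Sk n)"
    by (rule Q.short_exact_sequence_rel[OF sub(1,2)])
  interpret r: cochain_map "cochains P F" "cochains (Sk (n + 1)) F" "cochain_restrict (Sk (n + 1))"
    by (rule cochain_map_restrict[OF skeleton_subset])
  let ?b = "cochain_restrict (Sk (n + 1)) n s"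
  let ?a = "cochain_restrict (Sk (n + 1)) (n + 1) (dif (cochains P F) n s)"
  have "?b \<in> carrier (grp (rel_cochains (Sk (n + 1)) (Sk (n - 1)) F) n)"
    using s(1) unfolding K_def by (rule cochain_restrict_rel[OF sub(3) skeleton_subset])
  moreover have "?a \<in> carrier (grp (rel_cochains (Sk (n + 1)) (Sk n) F) (n + 1))"
    using s(2) unfolding K_def by (rule cochain_restrict_rel[OF sub(2) skeleton_subset])
  moreover have "?a = dif (rel_cochains (Sk (n + 1)) (Sk (n - 1)) F) n ?b"
    using s(1) rel_cochains_carrier by (simp add: r.map_dif K_def)
  ultimately have "connecting_hom (rel_cochains (Sk (n + 1)) (Sk n) F) (rel_cochains (Sk (n + 1)) (Sk (n - 1)) F)
      (\<lambda>m s. s) (cochain_restrict (Sk n)) n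
      (cohomology_class (rel_cochains (Sk n) (Sk (n - 1)) F) n (cochain_restrict (Sk n) n ?b))
    = cohomology_class (rel_cochains (Sk (n + 1)) (Sk n) F) (n + 1) ?a"
    by (rule e.connecting_hom_class)
  moreover have "cochain_restrict (Sk n) n ?b = cochain_restrict (Sk n) n s"
    using nerve_mono[OF sub(2), of n] by (auto simp: cochain_restrict_eq_iff cochain_restrict_apply subset_iff)
  ultimately show ?thesis by (simp add: cellular_differential_def cell_class_def)
qed

lemma graded_filtration_model_cellular: "graded_filtration_model (cochains P F) K (cellular_cochains P rk F) cell_class"
proof -
  interpret S: complete_filtration "cochains P F" K by (rule complete_filtration)
  have Q: "poset_presheaf (Sk n) F" for n by (rule poset_presheaf_subset[OF skeleton_subset])
  have D: "complex (rel_cochains (Sk n) (Sk (n - 1)) F)" for n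
    by (rule poset_presheaf.complex_rel_cochains[OF Q skeleton_pred])
  have cocycle: "cochain_restrict (Sk n) n s \<in> cocycles (rel_cochains (Sk n) (Sk (n - 1)) F) n"
    if "s \<in> K (n - 1) n" "dif (cochains P F) n s \<in> K n (n + 1)" for n s
    using that unfolding K_def by (rule restricted_cocycle[OF skeleton_pred skeleton_subset])
  show ?thesis
  proof (rule graded_filtration_model.intro[OF complete_filtration graded_filtration_model_axioms.intro])
    show "comm_group (grp (cellular_cochains P rk F) n)" for n
      using complex.comm_group_cohomology[OF D] by (simp add: cellular_cochains_def HS_rel_def)
    show "cell_class n \<in> hom ((grp (cochains P F) n)
        \<lparr>carrier := {s \<in> K (n - 1) n. dif (cochains P F) n s \<in> K n (n + 1)}\<rparr>) (grp (cellular_cochains P rk F) n)" for n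
    proof (rule homI)
      interpret D: complex "rel_cochains (Sk n) (Sk (n - 1)) F" by (rule D)
      fix s t
      assume "s \<in> carrier ((grp (cochains P F) n)
          \<lparr>carrier := {s \<in> K (n - 1) n. dif (cochains P F) n s \<in> K n (n + 1)}\<rparr>)"
        and "t \<in> carrier ((grp (cochains P F) n)
          \<lparr>carrier := {s \<in> K (n - 1) n. dif (cochains P F) n s \<in> K n (n + 1)}\<rparr>)"
      then have s: "s \<in> K (n - 1) n" "dif (cochains P F) n s \<in> K n (n + 1)"
        and t: "t \<in> K (n - 1) n" "dif (cochains P F) n t \<in> K n (n + 1)" by auto
      have "cochain_restrict (Sk n) n (s \<otimes>\<^bsub>grp (cochains P F) n\<^esub> t) =
          cochain_restrict (Sk n) n s \<otimes>\<^bsub>grp (rel_cochains (Sk n) (Sk (n - 1)) F) n\<^esub> cochain_restrict (Sk n) n t"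
        using hom_mult[OF restrict_skeleton_hom S.K_carrier[OF s(1)] S.K_carrier[OF t(1)]]
        by (simp add: poset_presheaf.rel_cochains_simps[OF Q])
      then show "cell_class n (s \<otimes>\<^bsub>(grp (cochains P F) n)
          \<lparr>carrier := {s \<in> K (n - 1) n. dif (cochains P F) n s \<in> K n (n + 1)}\<rparr>\<^esub> t) =
          cell_class n s \<otimes>\<^bsub>grp (cellular_cochains P rk F) n\<^esub> cell_class n t"
        using hom_mult[OF D.cohomology_class_hom, of "cochain_restrict (Sk n) n s" n "cochain_restrict (Sk n) n t"]
          cocycle[OF s] cocycle[OF t]
        by (simp add: cell_class_def cellular_cochains_def HS_rel_def)
    next
      fix s assume "s \<in> carrier ((grp (cochains P F) n)
          \<lparr>carrier := {s \<in> K (n - 1) n. dif (cochains P F) n s \<in> K n (n + 1)}\<rparr>)"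
      then show "cell_class n s \<in> carrier (grp (cellular_cochains P rk F) n)"
        using cocycle[of s n]
        by (simp add: cell_class_def cellular_cochains_def HS_rel_def complex.carrier_cohomology[OF D])
    qed
    show "cell_class n ` {s \<in> K (n - 1) n. dif (cochains P F) n s \<in> K n (n + 1)} =
        carrier (grp (cellular_cochains P rk F) n)" for n
    proof -
      interpret D: complex "rel_cochains (Sk n) (Sk (n - 1)) F" by (rule D)
      interpret r: cochain_map "cochains P F" "cochains (Sk n) F" "cochain_restrict (Sk n)"
        by (rule cochain_map_restrict[OF skeleton_subset])
      have "cochain_restrict (Sk n) n ` {s \<in> K (n - 1) n. dif (cochains P F) n s \<in> K n (n + 1)} =
          cocycles (rel_cochains (Sk n) (Sk (n - 1)) F) n"
      proof
        show "cochain_restrict (Sk n) n ` {s \<in> K (n - 1) n. dif (cochains P F) n s \<in> K n (n + 1)} \<subseteq>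
          cocycles (rel_cochains (Sk n) (Sk (n - 1)) F) n"
          using cocycle by blast
        show "cocycles (rel_cochains (Sk n) (Sk (n - 1)) F) n \<subseteq>
          cochain_restrict (Sk n) n ` {s \<in> K (n - 1) n. dif (cochains P F) n s \<in> K n (n + 1)}"
        proof
          fix z assume z: "z \<in> cocycles (rel_cochains (Sk n) (Sk (n - 1)) F) n"
          then obtain s where s: "s \<in> K (n - 1) n" "cochain_restrict (Sk n) n s = z"
            using cochain_restrict_surj[OF skeleton_pred skeleton_subset] unfolding K_def D.cocycles_iff by blast
          have sc: "s \<in> carrier (grp (cochains P F) n)" using s by (blast intro: S.K_carrier)
          have "cochain_restrict (Sk n) (n + 1) (dif (cochains P F) n s) = \<one>\<^bsub>grp (cochains (Sk n) F) (n + 1)\<^esub>"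
            using z s sc by (simp add: r.map_dif D.cocycles_iff poset_presheaf.rel_cochains_simps[OF Q])
          then have "dif (cochains P F) n s \<in> K n (n + 1)"
            using sc by (simp add: K_def rel_cochains_def kernel_def)
          then show "z \<in> cochain_restrict (Sk n) n ` {s \<in> K (n - 1) n. dif (cochains P F) n s \<in> K n (n + 1)}"
            using s by blast
        qed
      qed
      then show ?thesis
        unfolding cell_class_def cellular_cochains_def HS_rel_def
        by (simp add: D.carrier_cohomology flip: image_image)
    qed
    show "cell_class n s = \<one>\<^bsub>grp (cellular_cochains P rk F) n\<^esub> \<longleftrightarrow>
        (\<exists>u \<in> K (n - 1) (n - 1).
          s \<otimes>\<^bsub>grp (cochains P F) n\<^esub> inv\<^bsub>grp (cochains P F) n\<^esub> dif (cochains P F) (n - 1) u \<in> K n n)"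
      if "s \<in> K (n - 1) n" "dif (cochains P F) n s \<in> K n (n + 1)" for s n
      using restricted_class_eq_one_iff[OF skeleton_pred skeleton_subset, of s n] that
      by (simp add: K_def cell_class_def cellular_cochains_def)
    show "dif (cellular_cochains P rk F) n (cell_class n s) = cell_class (n + 1) (dif (cochains P F) n s)"
      if "s \<in> K (n - 1) n" "dif (cochains P F) n s \<in> K n (n + 1)" for s n
      using cell_class_differential[OF that] by (simp add: cellular_cochains_def)
  qed
qed

sublocale cell: graded_filtration_model "cochains P F" K "cellular_cochains P rk F" cell_class
  by (rule graded_filtration_model_cellular)

end

section \<open>Naturality\<close>

locale presheaf_morphism = F: poset_presheaf P F + G: poset_presheaf P G
  for P :: "'a::order set" and F G :: "('a, 'b) presheaf" +
  fixes \<eta> :: "'a \<Rightarrow> 'b \<Rightarrow> 'b"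
  assumes presheaf_hom: "presheaf_hom P F G \<eta>"
begin

lemma component_hom: "x \<in> P \<Longrightarrow> \<eta> x \<in> hom (obj F x) (obj G x)"
  using presheaf_hom by (simp add: presheaf_hom_def)

lemma component_res:
  "x \<in> P \<Longrightarrow> y \<in> P \<Longrightarrow> x \<le> y \<Longrightarrow> a \<in> carrier (obj F y) \<Longrightarrow> \<eta> x (res F y x a) = res G y x (\<eta> y a)"
  using presheaf_hom by (simp add: presheaf_hom_def)

lemma presheaf_morphism_subset: "Q \<subseteq> P \<Longrightarrow> presheaf_morphism Q F G \<eta>"
  by (simp add: presheaf_morphism_def presheaf_morphism_axioms_def F.poset_presheaf_subset
      G.poset_presheaf_subset presheaf_hom_def subset_iff component_hom component_res)

lemma push_apply: "\<sigma> \<in> nerve n P \<Longrightarrow> cochain_push P \<eta> n s \<sigma> = \<eta> (last \<sigma>) (s \<sigma>)"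
  by (simp add: cochain_push_def)

lemma push_closed:
  "s \<in> carrier (grp (cochains P F) n) \<Longrightarrow> cochain_push P \<eta> n s \<in> carrier (grp (cochains P G) n)"
  using hom_in_carrier[OF component_hom[OF last_nerve] F.cochain_value]
  by (simp add: cochains_def cochain_push_def)

lemma push_coface:
  assumes "s \<in> carrier (grp (cochains P F) (n - 1))" "\<sigma> \<in> nerve n P" "i < length \<sigma>" "2 \<le> length \<sigma>"
  shows "\<eta> (last \<sigma>) (coface F s \<sigma> i) = coface G (cochain_push P \<eta> (n - 1) s) \<sigma> i"
proof -
  note f = face_nerve[OF assms(2-4)]
  show ?thesis
    unfolding coface_def push_apply[OF f]
    by (rule component_res[OF last_nerve[OF assms(2)] last_nerve[OF f] last_le_last_face[OF assms(2-4)]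
          F.cochain_value[OF assms(1) f]])
qed

lemma cochain_map_push: "cochain_map (cochains P F) (cochains P G) (cochain_push P \<eta>)"
proof (rule cochain_map.intro[OF F.complex_cochains G.complex_cochains cochain_map_axioms.intro])
  interpret CF: complex "cochains P F" by (rule F.complex_cochains)
  interpret CG: complex "cochains P G" by (rule G.complex_cochains)
  show "cochain_push P \<eta> n \<in> hom (grp (cochains P F) n) (grp (cochains P G) n)" for n
  proof (rule homI)
    fix s t assume st: "s \<in> carrier (grp (cochains P F) n)" "t \<in> carrier (grp (cochains P F) n)"
    show "cochain_push P \<eta> n (s \<otimes>\<^bsub>grp (cochains P F) n\<^esub> t) =
        cochain_push P \<eta> n s \<otimes>\<^bsub>grp (cochains P G) n\<^esub> cochain_push P \<eta> n t"
    proof (rule G.cochains_ext)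
      fix \<sigma> assume \<sigma>: "\<sigma> \<in> nerve n P"
      then show "cochain_push P \<eta> n (s \<otimes>\<^bsub>grp (cochains P F) n\<^esub> t) \<sigma> =
          (cochain_push P \<eta> n s \<otimes>\<^bsub>grp (cochains P G) n\<^esub> cochain_push P \<eta> n t) \<sigma>"
        using hom_mult[OF component_hom[OF last_nerve[OF \<sigma>]] F.cochain_value[OF st(1) \<sigma>] F.cochain_value[OF st(2) \<sigma>]]
        by (simp add: push_apply F.cochains_mult G.cochains_mult)
    qed (use st in \<open>simp_all add: push_closed\<close>)
  qed (rule push_closed)
  fix s n assume s: "s \<in> carrier (grp (cochains P F) n)"
  show "cochain_push P \<eta> (n + 1) (dif (cochains P F) n s) = dif (cochains P G) n (cochain_push P \<eta> n s)"
  proof (rule G.cochains_ext)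
    fix \<sigma> assume \<sigma>: "\<sigma> \<in> nerve (n + 1) P"
    let ?A = "obj F (last \<sigma>)" and ?B = "obj G (last \<sigma>)"
    interpret A: comm_group ?A using \<sigma> by (intro F.obj_comm_group last_nerve)
    interpret B: comm_group ?B using \<sigma> by (intro G.obj_comm_group last_nerve)
    interpret h: group_hom ?A ?B "\<eta> (last \<sigma>)"
      by unfold_locales (rule component_hom[OF last_nerve[OF \<sigma>]])
    have "\<eta> (last \<sigma>) (cochain_differential P F n s \<sigma>) = cochain_differential P G n (cochain_push P \<eta> n s) \<sigma>"
    proof (cases "2 \<le> length \<sigma>")
      case True
      have c: "coface F s \<sigma> i \<in> carrier ?A" if "i < length \<sigma>" for i
        using F.coface_closed[of s "n + 1" \<sigma> i] s \<sigma> True that by simp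
      have e: "\<eta> (last \<sigma>) (coface F s \<sigma> i) = coface G (cochain_push P \<eta> n s) \<sigma> i" if "i < length \<sigma>" for i
        using push_coface[of s "n + 1" \<sigma> i] s \<sigma> True that by simp
      have "\<eta> (last \<sigma>) (cochain_differential P F n s \<sigma>) =
          (\<Otimes>\<^bsub>?B\<^esub>i\<in>{..<length \<sigma>}. \<eta> (last \<sigma>) (coface F s \<sigma> i [^]\<^bsub>?A\<^esub> ((- 1) ^ i :: int)))"
        unfolding F.differential_eq[OF s \<sigma> True]
        by (rule h.hom_finprod[OF A.comm_group_axioms B.comm_group_axioms]) (simp add: c)
      also have "\<dots> = (\<Otimes>\<^bsub>?B\<^esub>i\<in>{..<length \<sigma>}. coface G (cochain_push P \<eta> n s) \<sigma> i [^]\<^bsub>?B\<^esub> ((- 1) ^ i :: int))"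
        using c e h.hom_closed[OF c] by (intro B.finprod_cong') (auto simp: h.hom_int_pow)
      also have "\<dots> = cochain_differential P G n (cochain_push P \<eta> n s) \<sigma>"
        by (rule G.differential_eq[OF push_closed[OF s] \<sigma> True, symmetric])
      finally show ?thesis .
    next
      case False
      with \<sigma> have "length \<sigma> = 1" by (rule nerve_length_1)
      then show ?thesis using \<sigma> by (simp add: F.differential_length_1 G.differential_length_1)
    qed
    then show "cochain_push P \<eta> (n + 1) (dif (cochains P F) n s) \<sigma> =
        dif (cochains P G) n (cochain_push P \<eta> n s) \<sigma>"
      using \<sigma> by (simp add: push_apply) (simp add: cochains_def)
  qed (use s in \<open>simp_all add: push_closed\<close>)
qed

lemma push_rel:
  assumes "Q \<subseteq> P" "s \<in> carrier (grp (rel_cochains P Q F) n)"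
  shows "cochain_push P \<eta> n s \<in> carrier (grp (rel_cochains P Q G) n)"
proof -
  have "cochain_push P \<eta> n s \<sigma> = \<one>\<^bsub>obj G (last \<sigma>)\<^esub>" if \<sigma>: "\<sigma> \<in> nerve n Q" for \<sigma>
  proof -
    have \<sigma>P: "\<sigma> \<in> nerve n P" using \<sigma> nerve_mono[OF assms(1)] by blast
    interpret h: group_hom "obj F (last \<sigma>)" "obj G (last \<sigma>)" "\<eta> (last \<sigma>)"
      using component_hom[OF last_nerve[OF \<sigma>P]] F.obj_group[OF last_nerve[OF \<sigma>P]]
        G.obj_group[OF last_nerve[OF \<sigma>P]] by (simp add: group_hom_def group_hom_axioms_def)
    show ?thesis using \<sigma> \<sigma>P assms(2) by (simp add: push_apply F.carrier_rel_cochains)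
  qed
  then show ?thesis
    using assms(2) by (simp add: F.carrier_rel_cochains G.carrier_rel_cochains push_closed)
qed

lemma cochain_map_push_rel:
  assumes "Q \<subseteq> P"
  shows "cochain_map (rel_cochains P Q F) (rel_cochains P Q G) (cochain_push P \<eta>)"
proof (rule cochain_map.intro[OF F.complex_rel_cochains[OF assms] G.complex_rel_cochains[OF assms]
      cochain_map_axioms.intro])
  interpret p: cochain_map "cochains P F" "cochains P G" "cochain_push P \<eta>" by (rule cochain_map_push)
  show "cochain_push P \<eta> n \<in> hom (grp (rel_cochains P Q F) n) (grp (rel_cochains P Q G) n)" for n
    using push_rel[OF assms] by (intro homI) (simp_all add: F.rel_cochains_carrier)
  show "cochain_push P \<eta> (n + 1) (dif (rel_cochains P Q F) n x) =
      dif (rel_cochains P Q G) n (cochain_push P \<eta> n x)"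
    if "x \<in> carrier (grp (rel_cochains P Q F) n)" for x n
    using F.rel_cochains_carrier[OF that] by (simp add: p.map_dif)
qed

lemma restrict_push:
  assumes "Q \<subseteq> P"
  shows "cochain_restrict Q n (cochain_push P \<eta> n s) = cochain_push Q \<eta> n (cochain_restrict Q n s)"
  using nerve_mono[OF assms, of n] by (auto simp: cochain_restrict_def cochain_push_def fun_eq_iff restrict_def)

end

text \<open>
  The comparison map written out, so that it is defined for all \<open>F\<close> at once.
\<close>

definition cellular_comparison ::
    "'a::order set \<Rightarrow> ('a \<Rightarrow> int) \<Rightarrow> ('a, 'b) presheaf \<Rightarrow> int \<Rightarrow> ('a list \<Rightarrow> 'b) set \<Rightarrow> ('a list \<Rightarrow> 'b) set set" where
  "cellular_comparison P rk F n c =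
    (THE c'. \<exists>s \<in> c \<inter> carrier (grp (rel_cochains P (skeleton P rk (n - 1)) F) n).
       c' = cohomology_class (cellular_cochains P rk F) n
         (cohomology_class (rel_cochains (skeleton P rk n) (skeleton P rk (n - 1)) F) n
           (cochain_restrict (skeleton P rk n) n s)))"

context cellular_presheaf
begin

lemma comparison_eq: "cell.comparison n = cellular_comparison P rk F n"
  by (simp add: fun_eq_iff cell.comparison_def cellular_comparison_def K_def cell_class_def)

lemma cellular_comparison_iso: "cellular_comparison P rk F n \<in> iso (HS P F n) (HC P rk F n)"
  using cell.comparison_iso[of n] by (simp add: comparison_eq HS_def HC_def)

end

locale cellular_presheaf_morphism = F: cellular_presheaf P F rk + G: cellular_presheaf P G rk
  for P :: "'a::order set" and F G :: "('a, 'b) presheaf" and rk +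
  fixes \<eta> :: "'a \<Rightarrow> 'b \<Rightarrow> 'b"
  assumes presheaf_hom: "presheaf_hom P F G \<eta>"
begin

sublocale presheaf_morphism P F G \<eta>
  by unfold_locales (rule presheaf_hom)

sublocale push: cochain_map "cochains P F" "cochains P G" "cochain_push P \<eta>"
  by (rule cochain_map_push)

lemma push_K: "s \<in> F.K k n \<Longrightarrow> cochain_push P \<eta> n s \<in> G.K k n"
  unfolding F.K_def G.K_def by (rule push_rel[OF skeleton_subset])

lemma push_Z:
  assumes "s \<in> F.cell.Z n"
  shows "cochain_push P \<eta> n s \<in> G.cell.Z n"
  using assms push_K[of s "n - 1" n] push_K[of "dif (cochains P F) n s" n "n + 1"]
  by (simp add: F.cell.Z_iff G.cell.Z_iff push.map_dif F.cell.Z_carrier[OF assms])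

text \<open>
  This gives both that the induced map of cellular complexes is a cochain map and that the
  comparison map is natural.
\<close>

lemma cell_class_push:
  assumes s: "s \<in> F.cell.Z n"
  shows "HS_rel_map (skeleton P rk n) (skeleton P rk (n - 1)) G \<eta> n (F.cell_class n s) =
    G.cell_class n (cochain_push P \<eta> n s)"
proof -
  interpret Q: presheaf_morphism "skeleton P rk n" F G \<eta> by (rule presheaf_morphism_subset[OF skeleton_subset])
  interpret q: cochain_map "rel_cochains (skeleton P rk n) (skeleton P rk (n - 1)) F"
    "rel_cochains (skeleton P rk n) (skeleton P rk (n - 1)) G" "cochain_push (skeleton P rk n) \<eta>"
    by (rule Q.cochain_map_push_rel[OF F.skeleton_pred])
  have "cochain_restrict (skeleton P rk n) n s \<in>
      cocycles (rel_cochains (skeleton P rk n) (skeleton P rk (n - 1)) F) n"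
    using s unfolding F.cell.Z_iff F.K_def by (intro F.restricted_cocycle[OF F.skeleton_pred skeleton_subset]) auto
  then show ?thesis
    unfolding HS_rel_map_def F.cell_class_def G.cell_class_def restrict_push[OF skeleton_subset]
    by (rule q.cohomology_map_class)
qed

lemma cochain_map_cellular:
  "cochain_map (cellular_cochains P rk F) (cellular_cochains P rk G)
     (\<lambda>n. HS_rel_map (skeleton P rk n) (skeleton P rk (n - 1)) G \<eta> n)"
proof (rule cochain_map.intro[OF F.cell.complex_graded_pieces G.cell.complex_graded_pieces cochain_map_axioms.intro])
  show "HS_rel_map (skeleton P rk n) (skeleton P rk (n - 1)) G \<eta> n
      \<in> hom (grp (cellular_cochains P rk F) n) (grp (cellular_cochains P rk G) n)" for n
  proof -
    interpret Q: presheaf_morphism "skeleton P rk n" F G \<eta> by (rule presheaf_morphism_subset[OF skeleton_subset])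
    show ?thesis
      using cochain_map.cohomology_map_hom[OF Q.cochain_map_push_rel[OF F.skeleton_pred], of n]
      by (simp add: HS_rel_map_def cellular_cochains_def HS_rel_def)
  qed
  fix c n assume "c \<in> carrier (grp (cellular_cochains P rk F) n)"
  then obtain s where s: "s \<in> F.cell.Z n" "c = F.cell_class n s" using F.cell.\<gamma>_lift by blast
  have sc: "s \<in> carrier (grp (cochains P F) n)" using s by (blast intro: F.cell.Z_carrier)
  have "dif (cellular_cochains P rk F) n c = F.cell_class (n + 1) (dif (cochains P F) n s)"
    using s F.cell.dif_\<gamma> by (simp add: F.cell.Z_iff)
  then have "HS_rel_map (skeleton P rk (n + 1)) (skeleton P rk (n + 1 - 1)) G \<eta> (n + 1)
        (dif (cellular_cochains P rk F) n c)
      = G.cell_class (n + 1) (dif (cochains P G) n (cochain_push P \<eta> n s))"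
    using cell_class_push[OF F.cell.dif_Z[OF s(1)]] sc by (simp add: push.map_dif)
  also have "\<dots> = dif (cellular_cochains P rk G) n (G.cell_class n (cochain_push P \<eta> n s))"
    using push_Z[OF s(1)] G.cell.dif_\<gamma> by (simp add: G.cell.Z_iff)
  also have "G.cell_class n (cochain_push P \<eta> n s)
      = HS_rel_map (skeleton P rk n) (skeleton P rk (n - 1)) G \<eta> n c"
    using cell_class_push[OF s(1)] s(2) by simp
  finally show "HS_rel_map (skeleton P rk (n + 1)) (skeleton P rk (n + 1 - 1)) G \<eta> (n + 1)
        (dif (cellular_cochains P rk F) n c)
      = dif (cellular_cochains P rk G) n (HS_rel_map (skeleton P rk n) (skeleton P rk (n - 1)) G \<eta> n c)" .
qed

lemma cellular_comparison_natural:
  assumes "c \<in> carrier (HS P F n)"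
  shows "cellular_comparison P rk G n (HS_map P G \<eta> n c) = HC_map P rk G \<eta> n (cellular_comparison P rk F n c)"
proof -
  obtain s where s: "s \<in> F.cell.Zc n" "c = cohomology_class (cochains P F) n s"
    using assms F.cell.cohomology_class_eq_class_in_K unfolding HS_def F.cell.carrier_cohomology by blast
  have ps: "cochain_push P \<eta> n s \<in> G.cell.Zc n"
    using s(1) push_K[of s "n - 1" n] push.map_cocycle[OF F.cell.Zc_cocycle[OF s(1)]]
    by (simp add: F.cell.Zc_def G.cell.Zc_def G.cell.cocycles_iff)
  have "HS_map P G \<eta> n c = cohomology_class (cochains P G) n (cochain_push P \<eta> n s)"
    unfolding HS_map_def s(2) by (rule push.cohomology_map_class[OF F.cell.Zc_cocycle[OF s(1)]])
  then have "cellular_comparison P rk G n (HS_map P G \<eta> n c) =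
      cohomology_class (cellular_cochains P rk G) n (G.cell_class n (cochain_push P \<eta> n s))"
    using G.cell.comparison_class[OF ps] by (simp add: G.comparison_eq)
  also have "\<dots> = cohomology_class (cellular_cochains P rk G) n
      (HS_rel_map (skeleton P rk n) (skeleton P rk (n - 1)) G \<eta> n (F.cell_class n s))"
    using cell_class_push[OF F.cell.Zc_subset[OF s(1)]] by simp
  also have "\<dots> = HC_map P rk G \<eta> n (cohomology_class (cellular_cochains P rk F) n (F.cell_class n s))"
    unfolding HC_map_def
    by (rule cochain_map.cohomology_map_class[OF cochain_map_cellular F.cell.\<gamma>_cocycle[OF s(1)], symmetric])
  also have "cohomology_class (cellular_cochains P rk F) n (F.cell_class n s) = cellular_comparison P rk F n c"
    using F.cell.comparison_class[OF s(1)] s(2) by (simp add: F.comparison_eq)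
  finally show ?thesis .
qed

end

theorem theorem1:
  fixes P :: "'a::order set" and rk :: "'a \<Rightarrow> int"
  assumes "graded_with_corank P rk"
    and "locally_finite_poset P"
    and "cellular TYPE('b) P rk"
  shows "\<exists>\<phi> :: ('a, 'b) presheaf \<Rightarrow> int \<Rightarrow> ('a list \<Rightarrow> 'b) set \<Rightarrow> ('a list \<Rightarrow> 'b) set set.
    (\<forall>F. presheaf_on P F \<longrightarrow> (\<forall>n. \<phi> F n \<in> iso (HS P F n) (HC P rk F n))) \<and>
    (\<forall>F G \<eta>. presheaf_on P F \<longrightarrow> presheaf_on P G \<longrightarrow> presheaf_hom P F G \<eta> \<longrightarrow>
       (\<forall>n. \<forall>c \<in> carrier (HS P F n).
          \<phi> G n (HS_map P G \<eta> n c) = HC_map P rk G \<eta> n (\<phi> F n c)))"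
proof (intro exI conjI allI impI ballI)
  have cell: "cellular_presheaf P F rk" if "presheaf_on P F" for F :: "('a, 'b) presheaf"
    using assms(1,3) that
    by (simp add: cellular_presheaf_def cellular_presheaf_axioms_def poset_presheaf_def
        graded_with_corank_def cellular_def)
  show "cellular_comparison P rk F n \<in> iso (HS P F n) (HC P rk F n)"
    if "presheaf_on P F" for F :: "('a, 'b) presheaf" and n
    by (rule cellular_presheaf.cellular_comparison_iso[OF cell[OF that]])
  show "cellular_comparison P rk G n (HS_map P G \<eta> n c) = HC_map P rk G \<eta> n (cellular_comparison P rk F n c)"
    if "presheaf_on P F" "presheaf_on P G" "presheaf_hom P F G \<eta>" "c \<in> carrier (HS P F n)"
    for F G :: "('a, 'b) presheaf" and \<eta> n c
    by (rule cellular_presheaf_morphism.cellular_comparison_natural[OF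
          cellular_presheaf_morphism.intro[OF cell[OF that(1)] cell[OF that(2)]
            cellular_presheaf_morphism_axioms.intro[OF that(3)]] that(4)])
qed

end
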